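(* For every integer $n\ge2$, the discriminant of the polynomial $p_n(z;x,y)$ with respect to the variable $z$ coincides with the discriminant $\Delta(1,\theta,\dots,\theta^{n-1})$ for the field extension $\mathbb{Q}(x,y)\subset\mathbb{Q}(x,y)(\theta)$, where $\theta=(\sqrt[n]{x}+\sqrt[n]{y})^n$.
   Context: $x,y$ are algebraically independent variables. With $\varepsilon=e^{2\pi i/n}$, $p_n(z;x,y)=\prod_{r,s=1}^n(\sqrt[n]{z}+\varepsilon^r\sqrt[n]{x}+\varepsilon^s\sqrt[n]{y})$ (fixed branches of the roots), a symmetric polynomial in $x,y,z$ with integer coefficients, monic of degree $n$ in $z$. For a commutative ring $R$ with identity and a finite extension $R\subset S$ with $S$ a free $R$-module, the discriminant of elements $e_1,\dots,e_n\in S$ is $\Delta(e_1,\dots,e_n)=\det\bigl(\mathrm{Tr}_{S/R}(e_ie_j)\bigr)_{i,j}$, where $\mathrm{Tr}_{S/R}(a)$ is the trace of the $R$-linear map $S\to S$ of multiplication by $a$. *)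

theory Defs
  imports
    "HOL-Algebra.Algebraic_Closure_Type"
    "HOL-Algebra.Generated_Fields"
    Complex_Main
    "Subresultants.Resultant_Prelim"
begin

section \<open>Discriminant of a polynomial\<close>

text \<open>The normalisation is the usual one: for \<open>f = c \<Prod>(z - \<alpha>\<^sub>i)\<close> of degree \<open>n\<close> the value is
  \<open>c\<^bsup>2n-2\<^esup> \<Prod>\<^bsub>i<j\<^esub> (\<alpha>\<^sub>i - \<alpha>\<^sub>j)\<^sup>2\<close>, e.g. \<open>b\<^sup>2 - 4ac\<close> for \<open>az\<^sup>2 + bz + c\<close>. The division is exact, since
  the leading coefficient divides the first column of the Sylvester matrix of \<open>f\<close> and \<open>f'\<close>.
  Characteristic zero guarantees that \<open>f'\<close> has degree \<open>n - 1\<close>.\<close>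

definition poly_discriminant :: "'a::{idom_divide, ring_char_0} poly \<Rightarrow> 'a" where
  "poly_discriminant f =
     (-1) ^ (degree f * (degree f - 1) div 2) * (resultant f (pderiv f) div lead_coeff f)"


section \<open>Trace and discriminant in a finite free extension\<close>

text \<open>A ring extension \<open>R \<subset> S\<close> is given by a homomorphism \<open>h\<close> from the type of \<open>R\<close> to an ambient
  ring, together with a subring \<open>S\<close> of the ambient ring that contains the range of \<open>h\<close>.\<close>

definition ext_scale :: "('r::comm_ring_1 \<Rightarrow> 's::comm_ring_1) \<Rightarrow> 'r \<Rightarrow> 's \<Rightarrow> 's" where
  "ext_scale h c a = h c * a"

definition is_ext_basis :: "('r::comm_ring_1 \<Rightarrow> 's::comm_ring_1) \<Rightarrow> 's set \<Rightarrow> 's set \<Rightarrow> bool" where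
  "is_ext_basis h S B \<longleftrightarrow>
     finite B \<and> \<not> module.dependent (ext_scale h) B \<and> module.span (ext_scale h) B = S"

text \<open>The sum of the diagonal entries of the matrix of \<open>b \<mapsto> a b\<close> with respect to some basis of \<open>S\<close>
  over \<open>R\<close>; it does not depend on the basis.\<close>

definition ext_trace :: "('r::comm_ring_1 \<Rightarrow> 's::comm_ring_1) \<Rightarrow> 's set \<Rightarrow> 's \<Rightarrow> 'r" where
  "ext_trace h S a =
     (let B = (SOME B. is_ext_basis h S B)
      in \<Sum>b\<in>B. module.representation (ext_scale h) B (a * b) b)"

text \<open>The elements \<open>e 0, \<dots>, e (n - 1)\<close> are numbered from zero.\<close>

definition ext_discriminant ::
    "('r::comm_ring_1 \<Rightarrow> 's::comm_ring_1) \<Rightarrow> 's set \<Rightarrow> nat \<Rightarrow> (nat \<Rightarrow> 's) \<Rightarrow> 'r" where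
  "ext_discriminant h S n e = det (mat n n (\<lambda>(i, j). ext_trace h S (e i * e j)))"


section \<open>The field of rational functions and its extensions\<close>

text \<open>In the iterated polynomial types the inner variable is \<open>x\<close> and the outer one is \<open>y\<close>; in
  \<open>int poly poly poly\<close> the outermost variable is \<open>z\<close>. All roots and algebraic functions live in an
  algebraic closure of \<open>\<complex>(x,y)\<close>.\<close>

type_synonym Qxy = "rat poly poly fract"
type_synonym Cxy = "complex poly poly fract"
type_synonym Cxy_closure = "Cxy alg_closure"

definition Zxy_to_Qxy :: "int poly poly \<Rightarrow> Qxy" where
  "Zxy_to_Qxy c = to_fract (map_poly (map_poly of_int) c)"

definition Qxy_to_Cxy :: "Qxy \<Rightarrow> Cxy" where
  "Qxy_to_Cxy q =
     (case quot_of_fract q of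
        (a, b) \<Rightarrow> Fract (map_poly (map_poly of_rat) a) (map_poly (map_poly of_rat) b))"

definition Qxy_embed :: "Qxy \<Rightarrow> Cxy_closure" where
  "Qxy_embed q = to_ac (Qxy_to_Cxy q)"

definition X_var :: Qxy where
  "X_var = to_fract [:[:0, 1:]:]"

definition Y_var :: Qxy where
  "Y_var = to_fract [:0, 1:]"

definition root_of_unity :: "nat \<Rightarrow> Cxy_closure" where
  "root_of_unity n = to_ac (to_fract [:[: exp (2 * of_real pi * \<i> / of_nat n) :]:])"

text \<open>The field \<open>\<rat>(x,y)(\<theta>)\<close>.\<close>

definition Qxy_adjoin :: "Cxy_closure \<Rightarrow> Cxy_closure set" where
  "Qxy_adjoin \<theta> = generate_field ring_of_type_algebra (insert \<theta> (range Qxy_embed))"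


section \<open>The polynomials $p_n$\<close>

text \<open>Here \<open>u\<close> and \<open>v\<close> are the chosen \<open>n\<close>-th roots of \<open>x\<close> and \<open>y\<close>. Every element of the algebraic
  closure has the form \<open>z = w ^ n\<close>, with \<open>w\<close> an arbitrary branch of the \<open>n\<close>-th root of \<open>z\<close>.\<close>

definition p_poly :: "nat \<Rightarrow> Cxy_closure \<Rightarrow> Cxy_closure \<Rightarrow> int poly poly poly" where
  "p_poly n u v =
     (THE p. \<forall>w. poly (map_poly (\<lambda>c. Qxy_embed (Zxy_to_Qxy c)) p) (w ^ n) =
        (\<Prod>r=1..n. \<Prod>s=1..n. w + root_of_unity n ^ r * u + root_of_unity n ^ s * v))"

end

theory Submission
  imports Defs "Jordan_Normal_Form.Char_Poly"
begin

text \<open>Put \<open>\<theta>\<^sub>t = (u + \<epsilon>\<^sup>t v)\<^sup>n\<close> for \<open>t < n\<close>, where \<open>\<epsilon>\<close> is a primitive \<open>n\<close>-th root of unity. Multiplying out the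
  linear factors over \<open>r\<close> and \<open>s\<close> shows that the roots of \<open>p\<^sub>n\<close> as a polynomial in \<open>z\<close> are the numbers
  \<open>(-1)\<^sup>n \<theta>\<^sub>t\<close> (lemma \<open>double_prod_roots_of_unity\<close>). The conjugates of \<open>\<theta> = \<theta>\<^sub>0\<close> over \<open>\<rat>(x,y)\<close> are
  the numbers \<open>\<theta>\<^sub>t\<close>. Both discriminants therefore equal \<open>\<Prod>\<^bsub>j<k\<^esub> (\<theta>\<^sub>k - \<theta>\<^sub>j)\<^sup>2\<close>; the common sign \<open>(-1)\<^sup>n\<close>
  disappears in the squares.

  For the polynomial this is the evaluation of the resultant of \<open>f\<close> and \<open>f'\<close> at the roots of \<open>f\<close>
  (\<open>resultant_prod_roots\<close>, \<open>poly_discriminant_hom\<close>). For the extension, the trace of \<open>\<theta>\<^sup>k\<close> is the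
  power sum \<open>\<Sum>\<^sub>t \<theta>\<^sub>t\<^sup>k\<close>, so that the trace matrix is a Vandermonde matrix times its transpose
  (\<open>trace_power\<close>, \<open>discriminant_powers\<close>). Two facts about \<open>\<theta>\<close> are used there: the \<open>\<theta>\<^sub>t\<close> are distinct,
  and every polynomial over \<open>\<rat>(x,y)\<close> that vanishes at \<open>\<theta>\<close> vanishes at each \<open>\<theta>\<^sub>t\<close>.

  Both facts come from \<open>s = v / u\<close>, for which \<open>\<theta>\<^sub>t = x (1 + \<epsilon>\<^sup>t s)\<^sup>n\<close> and \<open>s\<^sup>n = y / x\<close>. Already over
  \<open>\<complex>(x,y)\<close> the minimal polynomial of \<open>s\<close> is \<open>T\<^sup>n - y/x\<close>: the constant term of a factor of degree
  \<open>d\<close> has \<open>n\<close>-th power \<open>\<plusminus>(y/x)\<^sup>d\<close>, and comparing degrees in \<open>y\<close> gives \<open>n dvd d\<close>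
  (\<open>kummer_divides\<close>, \<open>Y_over_X_power_no_root\<close>). Hence every relation satisfied by \<open>s\<close> is satisfied
  by \<open>\<epsilon>\<^sup>t s\<close>, and relations for \<open>\<theta>\<close> are relations for \<open>s\<close>.

  Finally the coefficients of \<open>p\<^sub>n\<close> are integral because \<open>p\<^sub>n\<close> is the characteristic polynomial of
  an explicit matrix over \<open>\<int>[x,y]\<close>, namely that of multiplication by \<open>(-1)\<^sup>n \<theta>\<close> on the elements
  \<open>v\<^sup>i u\<^bsup>n-i\<^esup>\<close> with \<open>i < n\<close> (\<open>shift_matrix\<close>, \<open>char_poly_shift_matrix\<close>). The same matrix over
  \<open>\<rat>(x,y)\<close>, with sign \<open>1\<close>, gives the minimal polynomial of \<open>\<theta>\<close>.\<close>

section \<open>Discriminants through roots\<close>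

unbundle no fps_syntax

lemma monic_poly_eq_prod_roots:
  fixes p :: "'a::idom poly"
  assumes "lead_coeff p = 1" "degree p = n" "inj_on \<alpha> {..<n}" "\<And>i. i < n \<Longrightarrow> poly p (\<alpha> i) = 0"
  shows "p = (\<Prod>i<n. [:- \<alpha> i, 1:])"
proof -
  have deg: "degree (\<Prod>i<n. [:- \<alpha> i, 1:]) = n"
    by (subst degree_prod_eq_sum_degree) auto
  show ?thesis
  proof (rule poly_eqI_degree_lead_coeff[of _ n _ "\<alpha> ` {..<n}"])
    have "lead_coeff (\<Prod>i<n. [:- \<alpha> i, 1:]) = (1::'a)" by (simp add: lead_coeff_prod)
    thus "coeff p n = coeff (\<Prod>i<n. [:- \<alpha> i, 1:]) n"
      using assms deg by simp
  qed (use assms deg in \<open>auto simp: card_image poly_prod\<close>)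
qed

text \<open>Multiplying the Vandermonde matrix from the left by the unitriangular matrix of coefficients of
  the Newton polynomials \<open>\<Prod>\<^bsub>j<k\<^esub> (z - \<alpha>\<^sub>j)\<close> replaces the powers by the values of these
  polynomials, which form an upper triangular matrix.\<close>

lemma det_vandermonde:
  fixes \<alpha> :: "nat \<Rightarrow> 'a::idom"
  shows "det (mat n n (\<lambda>(k, i). \<alpha> i ^ k)) = (\<Prod>k<n. \<Prod>j<k. \<alpha> k - \<alpha> j)"
proof -
  define q where "q k = (\<Prod>j<k. [:- \<alpha> j, 1:])" for k
  have deg: "degree (q k) = k" for k
    unfolding q_def by (subst degree_prod_eq_sum_degree) auto
  have lc: "coeff (q k) k = 1" for k
    using lead_coeff_prod[of "\<lambda>j. [:- \<alpha> j, 1:]" "{..<k}"] deg[of k] by (simp add: q_def)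
  define L where "L = mat n n (\<lambda>(k, j). coeff (q k) j)"
  define V where "V = mat n n (\<lambda>(k, i). \<alpha> i ^ k)"
  define U where "U = mat n n (\<lambda>(k, i). poly (q k) (\<alpha> i))"
  have LV: "L * V = U"
  proof (rule eq_matI)
    fix k i assume "k < dim_row U" "i < dim_col U"
    hence ki: "k < n" "i < n" by (auto simp: U_def)
    have "(L * V) $$ (k, i) = (\<Sum>j<n. coeff (q k) j * \<alpha> i ^ j)"
      using ki by (simp add: L_def V_def scalar_prod_def atLeast0LessThan)
    also have "\<dots> = (\<Sum>j\<le>k. coeff (q k) j * \<alpha> i ^ j)"
      by (rule sum.mono_neutral_right) (use ki in \<open>auto simp: deg coeff_eq_0\<close>)
    also have "\<dots> = U $$ (k, i)"
      using ki by (simp add: U_def poly_altdef deg)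
    finally show "(L * V) $$ (k, i) = U $$ (k, i)" .
  qed (auto simp: L_def V_def U_def)
  have "det L = prod_list (diag_mat L)"
    by (rule det_lower_triangular[of n]) (auto simp: L_def deg coeff_eq_0)
  also have "\<dots> = 1"
    by (simp add: L_def prod_list_diag_prod atLeast0LessThan lc)
  finally have L: "det L = 1" .
  have "det U = prod_list (diag_mat U)"
    by (rule det_upper_triangular[of _ n])
      (auto simp: U_def q_def poly_prod upper_triangular_def)
  also have "\<dots> = (\<Prod>k<n. poly (q k) (\<alpha> k))"
    by (simp add: U_def prod_list_diag_prod atLeast0LessThan)
  also have "\<dots> = (\<Prod>k<n. \<Prod>j<k. \<alpha> k - \<alpha> j)"
    by (simp add: q_def poly_prod)
  finally show ?thesis
    using det_mult[of L n V] L LV by (simp add: L_def V_def)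
qed

text \<open>A vector in the kernel of the transpose is the coefficient vector of a polynomial of degree less
  than \<open>n\<close> with \<open>n\<close> roots. Decreasing exponents match the order of the columns of the Sylvester
  matrix.\<close>

lemma det_reversed_vandermonde_nonzero:
  fixes \<alpha> :: "nat \<Rightarrow> 'a::idom"
  assumes inj: "inj_on \<alpha> {..<n}"
  shows "det (mat n n (\<lambda>(k, i). \<alpha> i ^ (n - Suc k))) \<noteq> 0"
proof
  define A where "A = mat n n (\<lambda>(i, k). \<alpha> i ^ (n - Suc k))"
  assume "det (mat n n (\<lambda>(k, i). \<alpha> i ^ (n - Suc k))) = 0"
  moreover have "transpose_mat A = mat n n (\<lambda>(k, i). \<alpha> i ^ (n - Suc k))"
    by (rule eq_matI) (auto simp: A_def)
  ultimately have "det A = 0"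
    using det_transpose[of A n] by (simp add: A_def)
  then obtain v where v: "v \<in> carrier_vec n" "v \<noteq> 0\<^sub>v n" "A *\<^sub>v v = 0\<^sub>v n"
    using det_0_iff_vec_prod_zero[of A n] by (auto simp: A_def)
  define p where "p = (\<Sum>k<n. monom (v $ (n - Suc k)) k)"
  have co: "coeff p k = v $ (n - Suc k)" if "k < n" for k
    using that by (simp add: p_def coeff_sum)
  have "p = 0"
  proof (rule poly_eqI_degree[of "\<alpha> ` {..<n}"])
    show "degree p < card (\<alpha> ` {..<n})"
    proof (cases "n = 0")
      case False
      have "degree p \<le> n - 1"
        unfolding p_def by (rule degree_sum_le) (auto intro: order_trans[OF degree_monom_le])
      thus ?thesis using False inj by (simp add: card_image)
    qed (use v in auto)
    thus "degree 0 < card (\<alpha> ` {..<n})" by simp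
    fix x assume "x \<in> \<alpha> ` {..<n}"
    then obtain i where i: "i < n" "x = \<alpha> i" by auto
    have "0 = (A *\<^sub>v v) $ i" using v i by simp
    also have "(A *\<^sub>v v) $ i = (\<Sum>k<n. \<alpha> i ^ (n - Suc k) * v $ k)"
      using i v(1) by (simp add: A_def scalar_prod_def atLeast0LessThan)
    also have "\<dots> = (\<Sum>k<n. \<alpha> i ^ k * v $ (n - Suc k))"
      by (subst sum.nat_diff_reindex[symmetric]) (rule sum.cong, auto)
    finally show "poly p x = poly 0 x"
      using i by (simp add: p_def poly_sum poly_monom mult.commute)
  qed
  have "v = 0\<^sub>v n"
  proof (rule eq_vecI)
    fix k assume "k < dim_vec (0\<^sub>v n :: 'a vec)"
    hence "k < n" by simp
    thus "v $ k = 0\<^sub>v n $ k"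
      using co[of "n - Suc k"] \<open>p = 0\<close> by simp
  qed (use v in auto)
  with v show False by simp
qed

text \<open>The \<open>i\<close>-th row of the Sylvester matrix lists the coefficients of a polynomial \<open>R i\<close>, which is
  \<open>f\<close> or \<open>g\<close> times a power of the variable. The matrix \<open>T\<close> below turns such a row into its leading
  \<open>m\<close> coefficients followed by the values of \<open>R i\<close> at the roots of \<open>f\<close>. The multiples of \<open>f\<close>
  vanish there, so the product is block triangular: one diagonal block is unitriangular, the other
  is the Vandermonde matrix with columns scaled by \<open>g(\<alpha>\<^sub>i)\<close>. The determinant of \<open>T\<close> is that of the
  same Vandermonde matrix and cancels.\<close>

lemma resultant_prod_roots:
  fixes f g :: "'a::idom poly" and n :: nat
  assumes inj: "inj_on \<alpha> {..<n}" and f: "f = (\<Prod>i<n. [:- \<alpha> i, 1:])"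
  shows "resultant f g = (\<Prod>i<n. poly g (\<alpha> i))"
proof -
  define m where "m = degree g"
  have deg: "degree f = n"
    unfolding f by (subst degree_prod_eq_sum_degree) auto
  have lc: "coeff f n = 1"
    using lead_coeff_prod[of "\<lambda>j. [:- \<alpha> j, 1:]" "{..<n}"] deg by (simp add: f)
  have root: "poly f (\<alpha> i) = 0" if "i < n" for i
    using that by (auto simp: f poly_prod)
  define S where "S = sylvester_mat f g"
  define R where "R i = (if i < m then monom 1 (m - Suc i) * f else monom 1 (m + n - Suc i) * g)" for i
  have S: "S \<in> carrier_mat (m + n) (m + n)"
    unfolding S_def using sylvester_carrier_mat[of f g] by (simp add: deg m_def add.commute)
  have Sij: "S $$ (i, j) = coeff (R i) (m + n - Suc j)" if ij: "i < m + n" "j < m + n" for i j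
  proof (cases "i < m")
    case True
    then obtain a b where ab: "m = Suc i + a" "m + n = Suc j + b"
      using ij by (metis Suc_leI add.commute le_iff_add add_Suc)
    have *: "monom (1::'a) (Suc a) * f = monom 1 1 * (monom 1 a * f)"
      by (simp add: mult_monom mult.assoc[symmetric])
    have "S $$ (i, j) = coeff (monom 1 (m - i) * f) (m + n - j)"
      unfolding S_def using sylvester_index_mat2[of i f g j] ij True
      by (simp add: deg m_def add.commute)
    also have "m - i = Suc a" using ab by simp
    also have "m + n - j = Suc b" using ab by simp
    also have "coeff (monom 1 (Suc a) * f) (Suc b) = coeff (monom 1 a * f) b"
      unfolding * by (subst coeff_monom_mult) simp
    also have "a = m - Suc i" using ab by simp
    also have "b = m + n - Suc j" using ab by simp
    finally show ?thesis using True by (simp add: R_def)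
  next
    case False
    then obtain a b where ab: "m + n = Suc i + a" "m + n = Suc j + b"
      using ij by (metis Suc_leI le_iff_add)
    have *: "monom (1::'a) (Suc a) * g = monom 1 1 * (monom 1 a * g)"
      by (simp add: mult_monom mult.assoc[symmetric])
    have "S $$ (i, j) = coeff (monom 1 (m + n - i) * g) (m + n - j)"
      unfolding S_def using sylvester_index_mat2[of i f g j] ij False
      by (simp add: deg m_def add.commute)
    also have "m + n - i = Suc a" using ab by simp
    also have "m + n - j = Suc b" using ab by simp
    also have "coeff (monom 1 (Suc a) * g) (Suc b) = coeff (monom 1 a * g) b"
      unfolding * by (subst coeff_monom_mult) simp
    also have "a = m + n - Suc i" using ab by simp
    also have "b = m + n - Suc j" using ab by simp
    finally show ?thesis using False by (simp add: R_def)
  qed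
  have degR: "degree (R i) < m + n" if "i < m + n" for i
  proof (cases "i < m")
    case True
    have "degree (R i) \<le> (m - Suc i) + n"
      using True degree_mult_le[of "monom 1 (m - Suc i)" f] by (simp add: R_def degree_monom_eq deg)
    thus ?thesis using True by linarith
  next
    case False
    have "degree (R i) \<le> (m + n - Suc i) + m"
      using False degree_mult_le[of "monom 1 (m + n - Suc i)" g]
      by (simp add: R_def degree_monom_eq m_def)
    thus ?thesis using False that by linarith
  qed
  have evalR: "(\<Sum>j<m + n. coeff (R i) (m + n - Suc j) * x ^ (m + n - Suc j)) = poly (R i) x"
    if i: "i < m + n" for i x
  proof -
    have "(\<Sum>j<m + n. coeff (R i) (m + n - Suc j) * x ^ (m + n - Suc j)) =
        (\<Sum>j<m + n. coeff (R i) j * x ^ j)"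
      by (rule sum.nat_diff_reindex)
    also have "\<dots> = (\<Sum>j\<le>degree (R i). coeff (R i) j * x ^ j)"
      by (rule sum.mono_neutral_right) (use degR[OF i] in \<open>auto simp: coeff_eq_0\<close>)
    finally show ?thesis by (simp add: poly_altdef)
  qed
  define V where "V = mat n n (\<lambda>(k, i). \<alpha> i ^ (n - Suc k))"
  define B where "B = mat m n (\<lambda>(k, i). \<alpha> i ^ (m + n - Suc k))"
  define T where "T = four_block_mat (1\<^sub>m m) B (0\<^sub>m n m) V"
  define U where "U = mat m m (\<lambda>(i, j). S $$ (i, j))"
  define C where "C = mat n m (\<lambda>(i, j). S $$ (i + m, j))"
  define D where "D = mat n n (\<lambda>(i, j). if i = j then poly g (\<alpha> i) else 0)"
  have T: "T \<in> carrier_mat (m + n) (m + n)"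
    unfolding T_def by (rule four_block_carrier_mat) (auto simp: V_def)
  have Tcol: "T $$ (j, c) = (if c < m then (if j = c then 1 else 0) else \<alpha> (c - m) ^ (m + n - Suc j))"
    if "j < m + n" "c < m + n" for j c
    using that by (auto simp: T_def V_def B_def add.commute)
  have ST: "S * T = four_block_mat U (0\<^sub>m m n) C (V * D)"
  proof (rule eq_matI)
    fix i c
    assume "i < dim_row (four_block_mat U (0\<^sub>m m n) C (V * D))"
      "c < dim_col (four_block_mat U (0\<^sub>m m n) C (V * D))"
    hence ic: "i < m + n" "c < m + n" by (auto simp: U_def C_def V_def D_def)
    have ST_sum: "(S * T) $$ (i, c) = (\<Sum>j<m + n. S $$ (i, j) * T $$ (j, c))"
      using ic S T by (simp add: scalar_prod_def atLeast0LessThan)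
    show "(S * T) $$ (i, c) = four_block_mat U (0\<^sub>m m n) C (V * D) $$ (i, c)"
    proof (cases "c < m")
      case True
      have "(\<Sum>j<m + n. S $$ (i, j) * T $$ (j, c)) = (\<Sum>j<m + n. if j = c then S $$ (i, j) else 0)"
        by (rule sum.cong) (use ic True Tcol in auto)
      also have "\<dots> = S $$ (i, c)" using ic by simp
      finally show ?thesis
        using ST_sum ic True by (auto simp: U_def C_def V_def D_def)
    next
      case False
      have c': "c - m < n" using False ic by auto
      have "(\<Sum>j<m + n. S $$ (i, j) * T $$ (j, c)) =
          (\<Sum>j<m + n. coeff (R i) (m + n - Suc j) * \<alpha> (c - m) ^ (m + n - Suc j))"
        by (rule sum.cong) (use ic False Tcol Sij in auto)
      also have "\<dots> = poly (R i) (\<alpha> (c - m))" by (rule evalR[OF ic(1)])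
      finally have *: "(S * T) $$ (i, c) = poly (R i) (\<alpha> (c - m))" using ST_sum by simp
      show ?thesis
      proof (cases "i < m")
        case True
        thus ?thesis using * False ic root[OF c'] by (simp add: R_def U_def V_def D_def)
      next
        case i: False
        have "(V * D) $$ (i - m, c - m) =
            (\<Sum>k<n. \<alpha> k ^ (n - Suc (i - m)) * (if k = c - m then poly g (\<alpha> k) else 0))"
          using i ic c' by (simp add: V_def D_def scalar_prod_def atLeast0LessThan)
        also have "\<dots> = (\<Sum>k<n. if k = c - m then \<alpha> k ^ (n - Suc (i - m)) * poly g (\<alpha> k) else 0)"
          by (rule sum.cong) auto
        also have "\<dots> = \<alpha> (c - m) ^ (n - Suc (i - m)) * poly g (\<alpha> (c - m))"
          using c' by simp
        finally have "(V * D) $$ (i - m, c - m) = \<dots>" .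
        moreover have "n - Suc (i - m) = m + n - Suc i" using i by simp
        ultimately show ?thesis
          using * i False ic by (simp add: R_def U_def V_def D_def poly_monom)
      qed
    qed
  qed (use S T in \<open>auto simp: U_def V_def C_def D_def\<close>)
  have "det T = det V"
    unfolding T_def by (subst det_four_block_mat_lower_left_zero[of _ m _ n]) (auto simp: B_def V_def)
  moreover have "det (S * T) = det U * (det V * det D)"
    unfolding ST by (subst det_four_block_mat_upper_right_zero[of _ m _ n])
      (auto simp: U_def V_def C_def D_def intro!: det_mult[of _ n])
  moreover have "det U = 1"
  proof -
    have "det U = prod_list (diag_mat U)"
    proof (rule det_upper_triangular[of _ m])
      show "upper_triangular U"
        by (auto simp: upper_triangular_def U_def Sij R_def coeff_monom_mult deg intro!: coeff_eq_0)
    qed (simp add: U_def)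
    also have "\<dots> = (\<Prod>i<m. coeff (R i) (m + n - Suc i))"
      by (simp add: U_def Sij prod_list_diag_prod atLeast0LessThan)
    also have "\<dots> = 1"
    proof (rule prod.neutral, rule ballI)
      fix i assume "i \<in> {..<m}"
      thus "coeff (R i) (m + n - Suc i) = 1"
        using lc by (simp add: R_def coeff_monom_mult)
    qed
    finally show ?thesis .
  qed
  moreover have "det D = (\<Prod>i<n. poly g (\<alpha> i))"
    by (subst det_upper_triangular[of _ n]) (auto simp: D_def prod_list_diag_prod atLeast0LessThan)
  moreover have "det V \<noteq> 0"
    unfolding V_def by (rule det_reversed_vandermonde_nonzero[OF inj])
  ultimately have "det S = (\<Prod>i<n. poly g (\<alpha> i))"
    using det_mult[OF S T] by simp
  thus ?thesis by (simp add: resultant_def S_def)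
qed

text \<open>Each unordered pair occurs twice on the left, with opposite signs.\<close>

lemma prod_differences_square:
  fixes \<alpha> :: "nat \<Rightarrow> 'a::idom"
  shows "(-1) ^ (n * (n - 1) div 2) * (\<Prod>i<n. \<Prod>j\<in>{..<n} - {i}. \<alpha> i - \<alpha> j) =
    (\<Prod>k<n. \<Prod>j<k. \<alpha> k - \<alpha> j)\<^sup>2"
proof (induction n)
  case (Suc n)
  have "(\<Prod>i<Suc n. \<Prod>j\<in>{..<Suc n} - {i}. \<alpha> i - \<alpha> j) =
      (\<Prod>i<n. (\<alpha> i - \<alpha> n) * (\<Prod>j\<in>{..<n} - {i}. \<alpha> i - \<alpha> j)) * (\<Prod>j<n. \<alpha> n - \<alpha> j)"
  proof -
    have "(\<Prod>j\<in>{..<Suc n} - {i}. \<alpha> i - \<alpha> j) = (\<alpha> i - \<alpha> n) * (\<Prod>j\<in>{..<n} - {i}. \<alpha> i - \<alpha> j)"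
      if "i < n" for i
    proof -
      have "{..<Suc n} - {i} = insert n ({..<n} - {i})" using that by auto
      thus ?thesis by simp
    qed
    moreover have "{..<Suc n} - {n} = {..<n}" by auto
    ultimately show ?thesis by simp
  qed
  also have "(\<Prod>i<n. (\<alpha> i - \<alpha> n) * (\<Prod>j\<in>{..<n} - {i}. \<alpha> i - \<alpha> j)) =
      (\<Prod>i<n. (-1) * (\<alpha> n - \<alpha> i)) * (\<Prod>i<n. \<Prod>j\<in>{..<n} - {i}. \<alpha> i - \<alpha> j)"
    by (simp add: prod.distrib[symmetric])
  also have "(\<Prod>i<n. (-1) * (\<alpha> n - \<alpha> i)) = (-1) ^ n * (\<Prod>i<n. \<alpha> n - \<alpha> i)"
    by (subst prod.distrib) simp
  finally have *: "(\<Prod>i<Suc n. \<Prod>j\<in>{..<Suc n} - {i}. \<alpha> i - \<alpha> j) =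
      (-1) ^ n * (\<Prod>i<n. \<Prod>j\<in>{..<n} - {i}. \<alpha> i - \<alpha> j) * (\<Prod>i<n. \<alpha> n - \<alpha> i)\<^sup>2"
    by (simp add: power2_eq_square)
  have "Suc n * (Suc n - 1) = n * (n - 1) + 2 * n"
    by (cases n) auto
  hence "Suc n * (Suc n - 1) div 2 = n * (n - 1) div 2 + n" by simp
  hence "(-1::'a) ^ (Suc n * (Suc n - 1) div 2) = (-1) ^ (n * (n - 1) div 2) * (-1) ^ n"
    by (simp only: power_add)
  moreover have "(-1::'a) ^ n * (-1) ^ n = 1" by (simp flip: power_add)
  ultimately show ?case
    unfolding * using Suc.IH by (simp add: power_mult_distrib ac_simps)
qed simp

text \<open>The resultant of \<open>f\<close> and \<open>f'\<close> commutes with the embedding into a field in which \<open>f\<close> splits, and the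
  value of \<open>f'\<close> at the root \<open>\<alpha>\<^sub>i\<close> is \<open>\<Prod>\<^bsub>j\<noteq>i\<^esub> (\<alpha>\<^sub>i - \<alpha>\<^sub>j)\<close>.\<close>

lemma poly_discriminant_hom:
  fixes hom :: "'a::{idom_divide, ring_char_0} \<Rightarrow> 'b::field" and n :: nat
  assumes hom: "inj_comm_ring_hom hom"
    and inj: "inj_on \<alpha> {..<n}" and split: "map_poly hom f = (\<Prod>i<n. [:- \<alpha> i, 1:])"
  shows "hom (poly_discriminant f) = (\<Prod>k<n. \<Prod>j<k. \<alpha> k - \<alpha> j)\<^sup>2"
proof -
  interpret inj_comm_ring_hom hom by (rule hom)
  have deg': "degree (map_poly hom f) = n"
    unfolding split by (subst degree_prod_eq_sum_degree) auto
  hence deg: "degree f = n" by simp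
  have "hom (lead_coeff f) = lead_coeff (map_poly hom f)"
    by simp
  also have "\<dots> = 1" unfolding split by (simp add: lead_coeff_prod)
  finally have lc: "lead_coeff f = 1" by simp
  have "map_poly hom (pderiv f) = pderiv (map_poly hom f)"
    by (rule poly_eqI) (simp add: coeff_pderiv hom_distribs)
  hence "hom (resultant f (pderiv f)) = (\<Prod>i<n. poly (pderiv (map_poly hom f)) (\<alpha> i))"
    using resultant_hom[of f "pderiv f"] resultant_prod_roots[OF inj split] by simp
  also have "\<dots> = (\<Prod>i<n. \<Prod>j\<in>{..<n} - {i}. \<alpha> i - \<alpha> j)"
  proof (rule prod.cong[OF refl])
    fix i assume i: "i \<in> {..<n}"
    have "poly (pderiv (map_poly hom f)) (\<alpha> i) = (\<Sum>k<n. \<Prod>j\<in>{..<n} - {k}. \<alpha> i - \<alpha> j)"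
      unfolding split by (simp add: pderiv_prod poly_sum poly_prod pderiv_pCons)
    also have "\<dots> = (\<Sum>k\<in>{i}. \<Prod>j\<in>{..<n} - {k}. \<alpha> i - \<alpha> j)"
      by (rule sum.mono_neutral_right) (use i in auto)
    finally show "poly (pderiv (map_poly hom f)) (\<alpha> i) = (\<Prod>j\<in>{..<n} - {i}. \<alpha> i - \<alpha> j)" by simp
  qed
  finally show ?thesis
    using prod_differences_square[of n \<alpha>] unfolding poly_discriminant_def lc
    by (simp add: hom_distribs deg)
qed

section \<open>Traces of linear maps\<close>

text \<open>The trace of an endomorphism \<open>f\<close> does not depend on the basis: the two base change matrices are
  inverse to each other. Since the trace of an extension refers to an unspecified basis, the
  trace can then be computed in a convenient one.\<close>

lemma (in vector_space) diagonal_sum_basis_independent: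
  assumes B: "finite B" "independent B" and C: "finite C" "independent C" and span: "span B = span C"
    and f: "\<And>x y. f (x + y) = f x + f y" "\<And>c x. f (scale c x) = scale c (f x)"
    and closed: "\<And>x. x \<in> span C \<Longrightarrow> f x \<in> span C"
  shows "(\<Sum>b\<in>B. representation B (f b) b) = (\<Sum>c\<in>C. representation C (f c) c)"
proof -
  have f0: "f 0 = 0" using f(2)[of 0 0] by simp
  have fsum: "f (\<Sum>x\<in>A. g x) = (\<Sum>x\<in>A. f (g x))" if "finite A" for A :: "'b set" and g
    using that by induction (auto simp: f f0)
  have inB: "x \<in> span B" if "x \<in> span C" for x using span that by simp
  have expand: "x = (\<Sum>d\<in>C. scale (representation C x d) d)" if "x \<in> span C" for x
    by (rule sum_representation_eq[OF C(2) that C(1), symmetric]) simp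
  have expandB: "x = (\<Sum>d\<in>B. scale (representation B x d) d)" if "x \<in> span C" for x
    by (rule sum_representation_eq[OF B(2) _ B(1), symmetric]) (use that span in auto)
  have CC: "c \<in> span C" if "c \<in> C" for c using that by (rule span_base)
  have BC: "b \<in> span C" if "b \<in> B" for b using that span span_base by blast
  have "(\<Sum>b\<in>B. representation B (f b) b) =
      (\<Sum>b\<in>B. \<Sum>c\<in>C. \<Sum>d\<in>C. representation C b c * representation C (f c) d * representation B d b)"
  proof (rule sum.cong[OF refl])
    fix b assume b: "b \<in> B"
    have "f b = (\<Sum>c\<in>C. scale (representation C b c) (f c))"
      by (subst expand[OF BC[OF b]]) (simp add: fsum C f)
    also have "\<dots> = (\<Sum>c\<in>C. \<Sum>d\<in>C. scale (representation C b c * representation C (f c) d) d)"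
    proof (rule sum.cong[OF refl])
      fix c assume "c \<in> C"
      thus "scale (representation C b c) (f c) =
          (\<Sum>d\<in>C. scale (representation C b c * representation C (f c) d) d)"
        by (subst expand[OF closed[OF CC]]) (simp_all add: scale_sum_right)
    qed
    finally have fb: "f b = (\<Sum>c\<in>C. \<Sum>d\<in>C. scale (representation C b c * representation C (f c) d) d)" .
    show "representation B (f b) b =
        (\<Sum>c\<in>C. \<Sum>d\<in>C. representation C b c * representation C (f c) d * representation B d b)"
      unfolding fb using B CC inB
      by (simp add: representation_sum representation_scale span_sum span_scale)
  qed
  also have "\<dots> = (\<Sum>c\<in>C. \<Sum>d\<in>C. \<Sum>b\<in>B. representation C b c * representation C (f c) d * representation B d b)"
    by (subst sum.swap, rule sum.cong[OF refl], subst sum.swap, rule refl)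
  also have "\<dots> = (\<Sum>c\<in>C. \<Sum>d\<in>C. representation C (f c) d * (if c = d then 1 else 0))"
  proof (intro sum.cong refl)
    fix c d assume cd: "c \<in> C" "d \<in> C"
    have "(\<Sum>b\<in>B. representation C b c * representation C (f c) d * representation B d b) =
        representation C (f c) d * representation C (\<Sum>b\<in>B. scale (representation B d b) b) c"
      using C BC by (simp add: representation_sum representation_scale span_scale sum_distrib_left ac_simps)
    also have "(\<Sum>b\<in>B. scale (representation B d b) b) = d"
      using expandB[OF CC[OF cd(2)]] by simp
    also have "representation C d c = (if c = d then 1 else 0)"
      using representation_basis[OF C(2) cd(2)] by auto
    finally show "(\<Sum>b\<in>B. representation C b c * representation C (f c) d * representation B d b) =
        representation C (f c) d * (if c = d then 1 else 0)" .
  qed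
  also have "\<dots> = (\<Sum>c\<in>C. representation C (f c) c)"
    using C by (intro sum.cong refl) (simp add: if_distrib sum.delta' cong: if_cong)
  finally show ?thesis .
qed

text \<open>The relation says that \<open>A\<close> is \<open>D\<close> conjugated by \<open>W\<close>. In this form it can be checked entry by
  entry, without the inverse of \<open>W\<close>.\<close>

lemma trace_eq_if_intertwined:
  fixes A D W :: "'a::field mat"
  assumes A: "A \<in> carrier_mat n n" and D: "D \<in> carrier_mat n n" and W: "W \<in> carrier_mat n n"
    and det: "det W \<noteq> 0" and eq: "A * W = W * D"
  shows "(\<Sum>i<n. A $$ (i, i)) = (\<Sum>i<n. D $$ (i, i))"
proof -
  obtain Y where Y: "Y \<in> carrier_mat n n" "Y * W = 1\<^sub>m n" "W * Y = 1\<^sub>m n"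
    using det_non_zero_imp_unit[OF W det] unfolding Units_def ring_mat_def by auto
  define Z where "Z = D * Y"
  have Z: "Z \<in> carrier_mat n n" using D Y by (simp add: Z_def)
  have "A = W * Z"
    using arg_cong[OF eq, of "\<lambda>M. M * Y"] A D W Y
    by (simp add: Z_def assoc_mult_mat[of _ n n _ n _ n])
  hence "(\<Sum>i<n. A $$ (i, i)) = (\<Sum>i<n. \<Sum>k<n. W $$ (i, k) * Z $$ (k, i))"
    using W Z by (simp add: scalar_prod_def atLeast0LessThan)
  also have "\<dots> = (\<Sum>k<n. \<Sum>i<n. Z $$ (k, i) * W $$ (i, k))"
    by (subst sum.swap) (simp add: mult.commute)
  also have "\<dots> = (\<Sum>k<n. (Z * W) $$ (k, k))"
    using W Z by (simp add: scalar_prod_def atLeast0LessThan)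
  also have "Z * W = D"
    using W D Y by (simp add: Z_def assoc_mult_mat[of _ n n _ n _ n])
  finally show ?thesis .
qed

section \<open>Power basis and conjugates of a primitive element\<close>

text \<open>The situation of a primitive element \<open>\<alpha> 0\<close> of degree \<open>n\<close> whose conjugates are the distinct
  elements \<open>\<alpha> i\<close>. The assumption \<open>conj\<close> replaces both the irreducibility of \<open>P\<close> and the existence of
  the embeddings that send \<open>\<alpha> 0\<close> to \<open>\<alpha> i\<close>.\<close>

locale conjugate_roots = field_hom h for h :: "'k::field \<Rightarrow> 'f::field" +
  fixes n :: nat and \<alpha> :: "nat \<Rightarrow> 'f" and P :: "'k poly"
  assumes n_pos: "0 < n"
    and split: "map_poly h P = (\<Prod>i<n. [:- \<alpha> i, 1:])"
    and distinct: "inj_on \<alpha> {..<n}"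
    and conj: "poly (map_poly h g) (\<alpha> 0) = 0 \<Longrightarrow> i < n \<Longrightarrow> poly (map_poly h g) (\<alpha> i) = 0"
begin

sublocale map_poly_hom: map_poly_inj_idom_hom h ..

abbreviation ev :: "'k poly \<Rightarrow> 'f" where "ev g \<equiv> poly (map_poly h g) (\<alpha> 0)"

abbreviation field_ext :: "'f set" where
  "field_ext \<equiv> generate_field ring_of_type_algebra (insert (\<alpha> 0) (range h))"

abbreviation powers :: "'f set" where "powers \<equiv> (\<lambda>i. \<alpha> 0 ^ i) ` {..<n}"

lemma degree_P: "degree P = n"
proof -
  have "degree (map_poly h P) = n"
    unfolding split by (subst degree_prod_eq_sum_degree) auto
  thus ?thesis by simp
qed

lemma ev_P: "ev P = 0"
  unfolding split using n_pos by (auto simp: poly_prod)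

text \<open>A polynomial over the base field that vanishes at \<open>\<alpha> 0\<close> has the \<open>n\<close> roots \<open>\<alpha> i\<close>.\<close>

lemma ev_low_degree:
  assumes "g \<noteq> 0" "degree g < n"
  shows "ev g \<noteq> 0"
proof
  assume "ev g = 0"
  hence roots: "\<alpha> ` {..<n} \<subseteq> {x. poly (map_poly h g) x = 0}" using conj by auto
  have nz: "map_poly h g \<noteq> 0" using assms by simp
  have "card (\<alpha> ` {..<n}) \<le> card {x. poly (map_poly h g) x = 0}"
    by (rule card_mono[OF poly_roots_finite[OF nz] roots])
  also have "\<dots> \<le> degree (map_poly h g)" by (rule card_poly_roots_bound[OF nz])
  finally show False using distinct assms by (simp add: card_image)
qed

lemma ev_mod: "ev (g mod P) = ev g"
proof -
  have "ev g = ev (P * (g div P) + g mod P)" by simp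
  also have "\<dots> = ev (g mod P)"
    unfolding map_poly_hom.hom_add map_poly_hom.hom_mult by (simp add: ev_P)
  finally show ?thesis ..
qed

lemma degree_mod_P: "degree (g mod P) < n"
  using degree_mod_less[of P g] degree_P n_pos by fastforce

text \<open>Inverses are found by a descending Euclidean argument: if \<open>P = g q + r\<close>, then an inverse of the
  value of \<open>r\<close> yields one of the value of \<open>g\<close>.\<close>

lemma ev_inverse:
  assumes "ev g \<noteq> 0"
  shows "\<exists>k. ev g * ev k = 1"
proof -
  have low: "\<exists>k. ev g * ev k = 1" if "g \<noteq> 0" "degree g < n" for g
    using that
  proof (induction "degree g" arbitrary: g rule: less_induct)
    case less
    show ?case
    proof (cases "degree g = 0")
      case True
      then obtain c where c: "g = [:c:]" by (rule degree_eq_zeroE)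
      hence "ev g * ev [:inverse c:] = 1" using less.prems by (simp add: hom_distribs)
      thus ?thesis ..
    next
      case False
      define q r where "q = P div g" and "r = P mod g"
      have "degree r < degree g"
        using degree_mod_less[of g P] False by (fastforce simp: r_def)
      have "0 = ev (g * q + r)" by (simp add: q_def r_def ev_P)
      hence ev_r: "ev g * ev q = - ev r"
        unfolding map_poly_hom.hom_add map_poly_hom.hom_mult by (simp add: eq_neg_iff_add_eq_0)
      have "r \<noteq> 0"
      proof
        assume "r = 0"
        hence P: "g * q = P" unfolding q_def r_def using mult_div_mod_eq[of g P] by simp
        have "P \<noteq> 0" using degree_P n_pos by auto
        hence "q \<noteq> 0" using P by auto
        moreover have "degree q < n"
          using degree_mult_eq[of g q] \<open>q \<noteq> 0\<close> less.prems(1) False degree_P P by simp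
        moreover note less.prems
        ultimately have "ev g * ev q \<noteq> 0"
          using ev_low_degree[of g] ev_low_degree[of q] by simp
        thus False
          using ev_r \<open>r = 0\<close> by simp
      qed
      then obtain k where "ev r * ev k = 1"
        using less.hyps[OF \<open>degree r < degree g\<close>] \<open>degree r < degree g\<close> less.prems by auto
      hence "ev g * ev (- (q * k)) = 1"
        using ev_r by (simp add: map_poly_hom.hom_uminus map_poly_hom.hom_mult flip: mult.assoc)
      thus ?thesis ..
    qed
  qed
  have "g mod P \<noteq> 0" using assms ev_mod[of g] by auto
  from low[OF this degree_mod_P] show ?thesis by (simp add: ev_mod)
qed

lemma field_ext_eq: "field_ext = range ev"
proof
  show "field_ext \<subseteq> range ev"
  proof
    fix x assume "x \<in> field_ext"
    thus "x \<in> range ev"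
    proof induction
      case one
      have "\<one>\<^bsub>ring_of_type_algebra\<^esub> = ev 1" by (simp add: ring_of_type_algebra_def)
      thus ?case by (rule range_eqI)
    next
      case (incl x)
      have "ev [:0, 1:] = \<alpha> 0" "ev [:c:] = h c" for c by (simp_all add: hom_distribs)
      hence "\<alpha> 0 \<in> range ev" "h c \<in> range ev" for c by (metis rangeI)+
      thus ?case using incl by auto
    next
      case (a_inv x)
      then obtain g where "x = ev g" by auto
      hence "- x = ev (- g)" by (simp add: map_poly_hom.hom_uminus)
      moreover have "\<ominus>\<^bsub>ring_of_type_algebra\<^esub> x = - x"
      proof -
        interpret R: cring "ring_of_type_algebra :: 'f ring" by auto
        have "- x \<oplus>\<^bsub>ring_of_type_algebra\<^esub> x = \<zero>\<^bsub>ring_of_type_algebra\<^esub>"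
          by (simp add: ring_of_type_algebra_def)
        thus ?thesis by (intro R.minus_equality) (auto simp: ring_of_type_algebra_def)
      qed
      ultimately show ?case by (simp only: range_eqI)
    next
      case (m_inv x)
      then obtain g where g: "x = ev g" by auto
      have "x \<noteq> 0" using m_inv by (simp add: ring_of_type_algebra_def)
      then obtain k where k: "x * ev k = 1" using ev_inverse[of g] g by auto
      interpret R: field "ring_of_type_algebra :: 'f ring" by (rule field_from_type_algebra)
      have "inv\<^bsub>ring_of_type_algebra\<^esub> x = ev k"
        by (rule R.comm_inv_char) (use k in \<open>auto simp: ring_of_type_algebra_def\<close>)
      thus ?case by simp
    next
      case (eng_add x y)
      then obtain g k where "x = ev g" "y = ev k" by auto
      hence "x \<oplus>\<^bsub>ring_of_type_algebra\<^esub> y = ev (g + k)"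
        by (simp add: map_poly_hom.hom_add ring_of_type_algebra_def)
      thus ?case by (rule range_eqI)
    next
      case (eng_mult x y)
      then obtain g k where "x = ev g" "y = ev k" by auto
      hence "x \<otimes>\<^bsub>ring_of_type_algebra\<^esub> y = ev (g * k)"
        by (simp add: map_poly_hom.hom_mult ring_of_type_algebra_def)
      thus ?case by (rule range_eqI)
    qed
  qed
  show "range ev \<subseteq> field_ext"
  proof
    have add: "x + y \<in> field_ext" if "x \<in> field_ext" "y \<in> field_ext" for x y
      using generate_field.eng_add[OF that] by (simp add: ring_of_type_algebra_def)
    have mult: "x * y \<in> field_ext" if "x \<in> field_ext" "y \<in> field_ext" for x y
      using generate_field.eng_mult[OF that] by (simp add: ring_of_type_algebra_def)
    have "ev g \<in> field_ext" for g
    proof (induction g)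
      case 0
      have "h 0 \<in> field_ext" by (rule generate_field.incl) blast
      thus ?case by simp
    next
      case (pCons c g)
      have "h c \<in> field_ext" "\<alpha> 0 \<in> field_ext" by (auto intro: generate_field.incl)
      thus ?case using pCons by (simp add: hom_distribs add mult)
    qed
    thus "x \<in> field_ext" if "x \<in> range ev" for x using that by auto
  qed
qed

sublocale vs: vector_space "ext_scale h"
  by unfold_locales (simp_all add: ext_scale_def hom_distribs algebra_simps)

lemma inj_powers: "inj_on (\<lambda>i. \<alpha> 0 ^ i) {..<n}"
proof (rule linorder_inj_onI)
  fix i j assume ij: "i < j" "i \<in> {..<n}" "j \<in> {..<n}"
  show "\<alpha> 0 ^ i \<noteq> \<alpha> 0 ^ j"
  proof
    assume eq: "\<alpha> 0 ^ i = \<alpha> 0 ^ j"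
    define g :: "'k poly" where "g = monom 1 j - monom 1 i"
    have "coeff g j \<noteq> 0" using ij by (simp add: g_def)
    moreover have "degree g \<le> j"
      unfolding g_def by (rule degree_diff_le) (use ij in \<open>auto simp: degree_monom_eq\<close>)
    moreover have "ev g = 0"
      unfolding g_def map_poly_hom.hom_minus by (simp add: poly_monom eq)
    moreover have "g \<noteq> 0" using \<open>coeff g j \<noteq> 0\<close> by auto
    ultimately show False using ev_low_degree[of g] ij by simp
  qed
qed auto

lemma ev_sum_monom: "ev (\<Sum>i<n. monom (c i) i) = (\<Sum>i<n. h (c i) * \<alpha> 0 ^ i)"
  unfolding map_poly_hom.hom_sum by (simp add: poly_sum poly_monom)

lemma sum_powers: "(\<Sum>x\<in>powers. F x) = (\<Sum>i<n. F (\<alpha> 0 ^ i))"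
  by (rule sum.reindex_cong[OF inj_powers]) auto

lemma powers_independent: "vs.independent powers"
proof
  assume "vs.dependent powers"
  then obtain c where c: "\<exists>x\<in>powers. c x \<noteq> 0" "(\<Sum>x\<in>powers. ext_scale h (c x) x) = 0"
    using vs.dependent_finite[of powers] by blast
  define g where "g = (\<Sum>i<n. monom (c (\<alpha> 0 ^ i)) i)"
  have co: "coeff g i = c (\<alpha> 0 ^ i)" if "i < n" for i
    using that by (simp add: g_def coeff_sum)
  obtain i where "i < n" "c (\<alpha> 0 ^ i) \<noteq> 0" using c(1) by blast
  hence "g \<noteq> 0" using co[of i] by auto
  moreover have "degree g \<le> n - 1"
    unfolding g_def by (rule degree_sum_le) (auto intro: order_trans[OF degree_monom_le])
  moreover have "ev g = 0"
    unfolding g_def ev_sum_monom using c(2) by (simp add: sum_powers ext_scale_def)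
  ultimately show False using ev_low_degree[of g] n_pos by simp
qed

lemma span_powers: "vs.span powers = field_ext"
proof -
  have "vs.span powers = range (\<lambda>c. \<Sum>x\<in>powers. ext_scale h (c x) x)"
    by (rule vs.span_finite) simp
  also have "\<dots> = range ev"
  proof (intro equalityI subsetI)
    fix x assume "x \<in> range (\<lambda>c. \<Sum>x\<in>powers. ext_scale h (c x) x)"
    then obtain c where "x = (\<Sum>x\<in>powers. ext_scale h (c x) x)" by auto
    hence "x = ev (\<Sum>i<n. monom (c (\<alpha> 0 ^ i)) i)"
      unfolding ev_sum_monom by (simp add: sum_powers ext_scale_def)
    thus "x \<in> range ev" by (rule range_eqI)
  next
    fix x assume "x \<in> range ev"
    then obtain g where "x = ev g" by (rule rangeE)
    hence g: "x = ev (g mod P)" by (simp only: ev_mod)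
    define c where "c y = coeff (g mod P) (the_inv_into {..<n} (\<lambda>i. \<alpha> 0 ^ i) y)" for y
    have "g mod P = (\<Sum>i<n. monom (coeff (g mod P) i) i)"
      using poly_as_sum_of_monoms'[of "g mod P" "n - 1"] degree_mod_P[of g] n_pos
      by (simp add: lessThan_Suc_atMost[symmetric])
    hence "x = (\<Sum>i<n. h (coeff (g mod P) i) * \<alpha> 0 ^ i)"
      using g ev_sum_monom[of "coeff (g mod P)"] by simp
    also have "\<dots> = (\<Sum>x\<in>powers. ext_scale h (c x) x)"
      by (simp add: sum_powers ext_scale_def c_def the_inv_into_f_f[OF inj_powers])
    finally show "x \<in> range (\<lambda>c. \<Sum>x\<in>powers. ext_scale h (c x) x)"
      by (rule range_eqI[of _ _ c])
  qed
  also have "\<dots> = field_ext" by (rule field_ext_eq[symmetric])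
  finally show ?thesis .
qed

lemma powers_basis: "is_ext_basis h field_ext powers"
  unfolding is_ext_basis_def using powers_independent span_powers by simp

text \<open>In the basis of powers, multiplication by \<open>\<alpha> 0 ^ k\<close> has a matrix over the base field. Its defining
  relations also hold at each conjugate, so the Vandermonde matrix conjugates it to the
  diagonal matrix with entries \<open>\<alpha> t ^ k\<close>.\<close>

lemma trace_power: "h (ext_trace h field_ext (\<alpha> 0 ^ k)) = (\<Sum>i<n. \<alpha> i ^ k)"
proof -
  define B where "B = (SOME B. is_ext_basis h field_ext B)"
  have "is_ext_basis h field_ext B"
    unfolding B_def by (rule someI[of _ powers], rule powers_basis)
  hence B: "finite B" "vs.independent B" "vs.span B = vs.span powers"
    by (simp_all add: is_ext_basis_def span_powers)
  have closed: "\<alpha> 0 ^ m * x \<in> vs.span powers" if x: "x \<in> vs.span powers" for x m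
  proof -
    obtain g where "x = ev g"
      using x unfolding span_powers field_ext_eq by (rule rangeE)
    hence "\<alpha> 0 ^ m * x = ev (monom 1 m * g)"
      unfolding map_poly_hom.hom_mult by (simp add: poly_monom)
    thus ?thesis unfolding span_powers field_ext_eq by (rule range_eqI)
  qed
  define c where "c i j = vs.representation powers (\<alpha> 0 ^ (k + i)) (\<alpha> 0 ^ j)" for i j
  have "ext_trace h field_ext (\<alpha> 0 ^ k) = (\<Sum>b\<in>B. vs.representation B (\<alpha> 0 ^ k * b) b)"
    by (simp add: ext_trace_def Let_def B_def)
  also have "\<dots> = (\<Sum>b\<in>powers. vs.representation powers (\<alpha> 0 ^ k * b) b)"
    by (rule vs.diagonal_sum_basis_independent[OF B(1,2) _ powers_independent B(3)])
      (use closed in \<open>auto simp: ext_scale_def algebra_simps\<close>)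
  also have "\<dots> = (\<Sum>i<n. c i i)"
    by (simp add: sum_powers c_def power_add)
  finally have trace: "ext_trace h field_ext (\<alpha> 0 ^ k) = (\<Sum>i<n. c i i)" .

  have expand: "\<alpha> t ^ (k + i) = (\<Sum>j<n. h (c i j) * \<alpha> t ^ j)" if t: "t < n" and i: "i < n" for t i
  proof -
    define g where "g = monom 1 (k + i) - (\<Sum>j<n. monom (c i j) j)"
    have g: "poly (map_poly h g) x = x ^ (k + i) - (\<Sum>j<n. h (c i j) * x ^ j)" for x
      unfolding g_def map_poly_hom.hom_minus map_poly_hom.hom_sum by (simp add: poly_sum poly_monom)
    have "\<alpha> 0 ^ i \<in> vs.span powers" using i by (intro vs.span_base) auto
    hence "\<alpha> 0 ^ (k + i) \<in> vs.span powers"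
      using closed[of "\<alpha> 0 ^ i" k] by (simp add: power_add)
    hence "\<alpha> 0 ^ (k + i) = (\<Sum>b\<in>powers. ext_scale h (vs.representation powers (\<alpha> 0 ^ (k + i)) b) b)"
      by (intro vs.sum_representation_eq[symmetric] powers_independent) auto
    hence "ev g = 0"
      by (simp add: g sum_powers c_def ext_scale_def)
    from conj[OF this t] show ?thesis by (simp add: g)
  qed
  define A where "A = mat n n (\<lambda>(i, j). h (c i j))"
  define W where "W = mat n n (\<lambda>(j, t). \<alpha> t ^ j)"
  define D where "D = mat n n (\<lambda>(s, t). if s = t then \<alpha> t ^ k else 0)"
  have "(\<Sum>i<n. A $$ (i, i)) = (\<Sum>i<n. D $$ (i, i))"
  proof (rule trace_eq_if_intertwined)
    show "det W \<noteq> 0"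
      unfolding W_def det_vandermonde by (fastforce dest: inj_onD[OF distinct])
    show "A * W = W * D"
    proof (rule eq_matI)
      fix i t assume "i < dim_row (W * D)" "t < dim_col (W * D)"
      hence it: "i < n" "t < n" by (auto simp: W_def D_def)
      have "(W * D) $$ (i, t) = (\<Sum>s<n. \<alpha> s ^ i * (if s = t then \<alpha> t ^ k else 0))"
        using it by (simp add: W_def D_def scalar_prod_def atLeast0LessThan)
      also have "\<dots> = (\<Sum>s<n. if s = t then \<alpha> s ^ i * \<alpha> t ^ k else 0)"
        by (rule sum.cong) auto
      also have "\<dots> = \<alpha> t ^ (k + i)" using it by (simp add: power_add mult.commute)
      finally show "(A * W) $$ (i, t) = (W * D) $$ (i, t)"
        using expand[OF it(2,1)] it by (simp add: A_def W_def scalar_prod_def atLeast0LessThan)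
    qed (auto simp: A_def W_def D_def)
  qed (auto simp: A_def W_def D_def)
  thus ?thesis unfolding trace by (simp add: A_def D_def hom_distribs)
qed

lemma discriminant_powers:
  "h (ext_discriminant h field_ext n (\<lambda>i. \<alpha> 0 ^ i)) = (\<Prod>k<n. \<Prod>j<k. \<alpha> k - \<alpha> j)\<^sup>2"
proof -
  define V where "V = mat n n (\<lambda>(k, i). \<alpha> i ^ k)"
  define M where "M = mat n n (\<lambda>(i, j). ext_trace h field_ext (\<alpha> 0 ^ i * \<alpha> 0 ^ j))"
  have V: "V \<in> carrier_mat n n" by (simp add: V_def)
  have "map_mat h M = V * transpose_mat V"
    by (rule eq_matI)
      (auto simp: M_def V_def scalar_prod_def atLeast0LessThan trace_power simp flip: power_add)
  hence "h (det M) = det V * det V"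
    using det_mult[OF V, of "transpose_mat V"] det_transpose[OF V] V by (simp flip: hom_det)
  thus ?thesis
    unfolding ext_discriminant_def M_def[symmetric] V_def det_vandermonde by (simp add: power2_eq_square)
qed

end

section \<open>Minimal polynomials of radicals\<close>

text \<open>If no \<open>a\<^sup>d\<close> with \<open>0 < d < n\<close> is an \<open>n\<close>-th power, then \<open>T\<^sup>n - a\<close> is the minimal polynomial of each
  of its roots. Indeed a polynomial \<open>g0\<close> of least degree \<open>d\<close> that vanishes at \<open>s\<close> divides \<open>T\<^sup>n - a\<close>,
  so all its roots have \<open>n\<close>-th power \<open>a\<close>. Up to sign and leading coefficient, its constant term is
  the product of \<open>d\<close> such roots, hence an element of the base field with \<open>n\<close>-th power \<open>a\<^sup>d\<close>.\<close>

lemma kummer_divides: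
  fixes h :: "'k::field \<Rightarrow> 'f::alg_closed_field"
  assumes hom: "field_hom h" and n: "0 < n" and s: "s ^ n = h a"
    and no_root: "\<And>d c. 0 < d \<Longrightarrow> d < n \<Longrightarrow> c ^ n \<noteq> a ^ d"
    and f: "poly (map_poly h f) s = 0"
  shows "monom 1 n - [:a:] dvd f"
proof -
  interpret field_hom h by (rule hom)
  interpret map_poly_hom: map_poly_inj_idom_hom h ..
  define Q where "Q = monom 1 n - [:a:]"
  have Q: "poly (map_poly h Q) x = x ^ n - h a" for x
    unfolding Q_def map_poly_hom.hom_minus by (simp add: poly_monom hom_distribs)
  have Qs: "poly (map_poly h Q) s = 0" by (simp add: Q s)
  have "coeff Q n = 1" using n by (cases n) (auto simp: Q_def)
  hence Q0: "Q \<noteq> 0" by auto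
  have dQ: "degree Q \<le> n"
    unfolding Q_def by (rule degree_diff_le) (auto simp: degree_monom_eq)
  have min: "n \<le> degree g" if "g \<noteq> 0" "poly (map_poly h g) s = 0" for g
  proof -
    define A where "A g \<longleftrightarrow> g \<noteq> 0 \<and> poly (map_poly h g) s = 0" for g
    have "A g" using that by (simp add: A_def)
    \<comment> \<open>\<open>g0\<close> is the minimal polynomial of \<open>s\<close>, up to a constant.\<close>
    then obtain g0 where g0: "A g0" "\<And>g. A g \<Longrightarrow> degree g0 \<le> degree g"
      using ex_has_least_nat[of A g degree] by blast
    define c where "c = lead_coeff g0"
    define d where "d = degree g0"
    have "c \<noteq> 0" using g0 by (simp add: A_def c_def)
    have "Q mod g0 = 0"
    proof (rule ccontr)
      assume nz: "Q mod g0 \<noteq> 0"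
      have "poly (map_poly h (g0 * (Q div g0) + Q mod g0)) s = 0"
        using Qs by simp
      hence "poly (map_poly h (Q mod g0)) s = 0"
        unfolding map_poly_hom.hom_add map_poly_hom.hom_mult using g0(1) by (simp add: A_def)
      hence "A (Q mod g0)" using nz by (simp add: A_def)
      thus False
        using g0 nz degree_mod_less[of g0 Q] by (fastforce simp: A_def)
    qed
    then obtain q where q: "Q = g0 * q" by blast
    obtain M where M: "size M = degree (map_poly h g0)"
      "map_poly h g0 = smult (lead_coeff (map_poly h g0)) (\<Prod>x\<in>#M. [:- x, 1:])"
      using alg_closed_imp_factorization[of "map_poly h g0"] g0(1) by (auto simp: A_def)
    have M': "size M = d" "map_poly h g0 = smult (h c) (\<Prod>x\<in>#M. [:- x, 1:])"
      using M by (simp_all add: d_def c_def)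
    have roots: "x ^ n = h a" if x: "x \<in># M" for x
    proof -
      obtain M1 where "M = add_mset x M1" using multi_member_split[OF x] by blast
      hence "poly (map_poly h g0) x = 0" using M'(2) by simp
      hence "poly (map_poly h Q) x = 0" unfolding q map_poly_hom.hom_mult by simp
      thus ?thesis by (simp add: Q)
    qed
    have prod_pow: "(\<Prod>x\<in>#N. x) ^ n = h a ^ size N" if "\<And>x. x \<in># N \<Longrightarrow> x ^ n = h a" for N
      using that by (induction N) (auto simp: power_mult_distrib)
    have "h (coeff g0 0) = poly (map_poly h g0) 0" by (simp add: poly_0_coeff_0)
    also have "\<dots> = h c * (\<Prod>x\<in>#M. - x)"
      unfolding M'(2) by (simp add: poly_prod_mset)
    also have "(\<Prod>x\<in>#M. - x) = (-1) ^ d * (\<Prod>x\<in>#M. x)"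
      unfolding M'(1)[symmetric] by (induction M) auto
    finally have "h ((-1) ^ d * coeff g0 0 / c) = (\<Prod>x\<in>#M. x)"
      using \<open>c \<noteq> 0\<close> by (simp add: hom_distribs flip: power_add mult_2)
    hence "h (((-1) ^ d * coeff g0 0 / c) ^ n) = h (a ^ d)"
      using prod_pow[of M] roots M'(1) unfolding hom_power by simp
    hence "((-1) ^ d * coeff g0 0 / c) ^ n = a ^ d" by simp
    moreover have "0 < d"
    proof (rule ccontr)
      assume "\<not> 0 < d"
      then obtain c where "g0 = [:c:]" unfolding d_def by (auto elim: degree_eq_zeroE)
      thus False using g0(1) by (simp add: A_def hom_distribs)
    qed
    ultimately have "n \<le> d" using no_root not_less by blast
    also have "d \<le> degree g" using g0(2)[of g] that by (simp add: A_def d_def)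
    finally show ?thesis .
  qed
  have "f mod Q = 0"
  proof (rule ccontr)
    assume nz: "f mod Q \<noteq> 0"
    have "poly (map_poly h (Q * (f div Q) + f mod Q)) s = 0" using f by simp
    hence "poly (map_poly h (f mod Q)) s = 0"
      unfolding map_poly_hom.hom_add map_poly_hom.hom_mult by (simp add: Qs)
    from min[OF nz this] show False
      using degree_mod_less[OF Q0, of f] nz dQ by linarith
  qed
  thus ?thesis unfolding Q_def by blast
qed

text \<open>Write \<open>c = a / b\<close> and compare degrees in \<open>y\<close>, the outer variable, on both sides of
  \<open>a\<^sup>n x\<^sup>d = y\<^sup>d b\<^sup>n\<close>.\<close>

lemma Y_over_X_power_no_root:
  fixes c :: Cxy
  assumes "0 < d" "d < n"
  shows "c ^ n \<noteq> (to_fract [:0, 1:] / to_fract [:[:0, 1:]:]) ^ d"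
proof
  assume eq: "c ^ n = (to_fract [:0, 1:] / to_fract [:[:0, 1:]:]) ^ d"
  obtain a b where ab: "c = Fract a b" "b \<noteq> 0" by (cases c)
  have pow: "Fract p q ^ k = Fract (p ^ k) (q ^ k)" for p q :: "complex poly poly" and k
    by (induction k) (auto simp: One_fract_def)
  have "Fract (a ^ n) (b ^ n) = Fract ([:0, 1:] ^ d) ([:[:0, 1:]:] ^ d)"
    using eq by (simp add: ab pow to_fract_def)
  hence eq2: "a ^ n * [:[:0, 1:]:] ^ d = [:0, 1:] ^ d * b ^ n"
    using ab by (simp add: eq_fract)
  hence "a \<noteq> 0" using ab assms by (auto simp: power_0_left)
  have "degree (a ^ n * [:[:0, 1:]:] ^ d) = n * degree a"
    using \<open>a \<noteq> 0\<close> by (simp add: degree_mult_eq degree_power_eq)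
  moreover have "degree ([:0, 1:] ^ d * b ^ n) = d + n * degree b"
    using ab by (simp add: degree_mult_eq degree_power_eq)
  ultimately have "n * degree a = d + n * degree b" using eq2 by simp
  hence "n dvd d" by (metis dvd_add_left_iff dvd_triv_left)
  thus False using assms by (auto dest: dvd_imp_le)
qed

section \<open>The fields of rational functions\<close>

text \<open>Needed so that a polynomial over the algebraic closure of \<open>\<complex>(x,y)\<close> is determined by its values.\<close>

instance fract :: ("{idom, ring_char_0}") field_char_0
  by standard (simp add: inj_on_def of_nat_fract eq_fract)

text \<open>Any representation of the fraction may be used in place of the normalized one.\<close>

lemma Qxy_to_Cxy_Fract:
  assumes "b \<noteq> 0"
  shows "Qxy_to_Cxy (Fract a b) =
    Fract (map_poly (map_poly of_rat) a) (map_poly (map_poly of_rat) b)"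
proof -
  interpret inj_idom_hom "of_rat :: rat \<Rightarrow> complex" by unfold_locales (auto simp: of_rat_add of_rat_mult)
  interpret p1: map_poly_inj_idom_hom "of_rat :: rat \<Rightarrow> complex" ..
  interpret p2: map_poly_inj_idom_hom "map_poly of_rat :: rat poly \<Rightarrow> complex poly" ..
  obtain a' b' where q: "quot_of_fract (Fract a b) = (a', b')" by fastforce
  have "b' \<noteq> 0" "Fract a' b' = Fract a b"
    using snd_quot_of_fract_nonzero[of "Fract a b"] Fract_quot_of_fract[of "Fract a b"] q by simp_all
  hence "a * b' = a' * b" using assms by (simp add: eq_fract)
  hence "map_poly (map_poly of_rat) a * map_poly (map_poly of_rat) b' =
      (map_poly (map_poly of_rat) a' * map_poly (map_poly of_rat) b :: complex poly poly)"
    by (simp flip: p2.hom_mult)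
  thus ?thesis
    using \<open>b' \<noteq> 0\<close> assms by (simp add: Qxy_to_Cxy_def q eq_fract)
qed

lemma field_hom_Qxy_to_Cxy: "field_hom Qxy_to_Cxy"
proof -
  interpret inj_idom_hom "of_rat :: rat \<Rightarrow> complex" by unfold_locales (auto simp: of_rat_add of_rat_mult)
  interpret p1: map_poly_inj_idom_hom "of_rat :: rat \<Rightarrow> complex" ..
  interpret p2: map_poly_inj_idom_hom "map_poly of_rat :: rat poly \<Rightarrow> complex poly" ..
  show ?thesis
  proof
    show "Qxy_to_Cxy 0 = 0" "Qxy_to_Cxy 1 = 1"
      by (simp_all add: Zero_fract_def One_fract_def Qxy_to_Cxy_Fract)
    fix x y :: Qxy
    obtain a b c d where "x = Fract a b" "b \<noteq> 0" "y = Fract c d" "d \<noteq> 0"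
      by (cases x, cases y) blast
    thus "Qxy_to_Cxy (x + y) = Qxy_to_Cxy x + Qxy_to_Cxy y"
      "Qxy_to_Cxy (x * y) = Qxy_to_Cxy x * Qxy_to_Cxy y"
      by (simp_all add: Qxy_to_Cxy_Fract p2.hom_add p2.hom_mult)
  qed
qed

lemma field_hom_to_ac: "field_hom (to_ac :: 'a::field \<Rightarrow> 'a alg_closure)"
  by unfold_locales simp_all

lemma field_hom_Qxy_embed: "field_hom Qxy_embed"
proof -
  interpret field_hom Qxy_to_Cxy by (rule field_hom_Qxy_to_Cxy)
  show ?thesis by unfold_locales (simp_all add: Qxy_embed_def hom_distribs)
qed

lemma inj_comm_ring_hom_Zxy_to_Qxy: "inj_comm_ring_hom Zxy_to_Qxy"
proof -
  interpret inj_idom_hom "of_int :: int \<Rightarrow> rat" by unfold_locales auto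
  interpret p1: map_poly_inj_idom_hom "of_int :: int \<Rightarrow> rat" ..
  interpret p2: map_poly_inj_idom_hom "map_poly of_int :: int poly \<Rightarrow> rat poly" ..
  show ?thesis by unfold_locales (auto simp: Zxy_to_Qxy_def hom_distribs p2.hom_add p2.hom_mult)
qed

lemma Qxy_embed_vars:
  "Qxy_embed X_var = to_ac (to_fract [:[:0, 1:]:])" "Qxy_embed Y_var = to_ac (to_fract [:0, 1:])"
proof -
  have "Qxy_to_Cxy (to_fract c) = to_fract (map_poly (map_poly of_rat) c)" for c
    unfolding to_fract_def by (subst Qxy_to_Cxy_Fract) auto
  thus "Qxy_embed X_var = to_ac (to_fract [:[:0, 1:]:])" "Qxy_embed Y_var = to_ac (to_fract [:0, 1:])"
    unfolding Qxy_embed_def X_var_def Y_var_def by (simp_all add: map_poly_pCons)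
qed

lemma root_of_unity_power_eq:
  "root_of_unity n ^ k = to_ac (to_fract [:[: cis (2 * pi * real k / real n) :]:])"
proof -
  have "root_of_unity n ^ k = to_ac (to_fract [:[:exp (2 * of_real pi * \<i> / of_nat n) ^ k:]:])"
    by (induction k)
      (simp_all add: root_of_unity_def pCons_one flip: to_ac_mult to_fract_mult)
  also have "exp (2 * of_real pi * \<i> / of_nat n) ^ k = cis (2 * pi * real k / real n)"
    by (simp add: cis_conv_exp algebra_simps flip: exp_of_nat_mult)
  finally show ?thesis .
qed

lemma root_of_unity_power: "0 < n \<Longrightarrow> root_of_unity n ^ n = 1"
  by (simp add: root_of_unity_power_eq pCons_one)

lemma inj_root_of_unity_power: "inj_on (\<lambda>k. root_of_unity n ^ k) {..<n}"
proof (rule inj_onI)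
  fix i j assume ij: "i \<in> {..<n}" "j \<in> {..<n}" "root_of_unity n ^ i = root_of_unity n ^ j"
  hence "cis (2 * pi * real i / real n) = cis (2 * pi * real j / real n)"
    by (simp add: root_of_unity_power_eq)
  moreover have "inj_on (\<lambda>k. cis (2 * pi * real k / real n)) {..<n}"
    using bij_betw_roots_unity[of n] ij by (auto simp: bij_betw_def)
  ultimately show "i = j" using ij by (auto dest: inj_onD)
qed

section \<open>Products over roots of unity\<close>

lemma prod_roots_of_unity:
  fixes w b \<epsilon> :: "'a::field"
  assumes n: "0 < n" and \<epsilon>: "\<epsilon> ^ n = 1" and inj: "inj_on (\<lambda>k. \<epsilon> ^ k) {..<n}"
  shows "(\<Prod>k<n. w + \<epsilon> ^ k * b) = w ^ n - (- b) ^ n"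
proof (cases "b = 0")
  case True
  thus ?thesis using n by (simp add: power_0_left)
next
  case False
  define p where "p = monom 1 n - [:(- b) ^ n:]"
  have lc: "coeff p n = 1" using n by (cases n) (auto simp: p_def)
  have "degree p \<le> n" unfolding p_def by (rule degree_diff_le) (auto simp: degree_monom_eq)
  moreover have "n \<le> degree p" using lc by (intro le_degree) simp
  ultimately have deg: "degree p = n" by simp
  have "p = (\<Prod>k<n. [:- (- (\<epsilon> ^ k * b)), 1:])"
  proof (rule monic_poly_eq_prod_roots)
    show "inj_on (\<lambda>k. - (\<epsilon> ^ k * b)) {..<n}"
      using inj False by (simp add: inj_on_def)
    fix k
    have "(- (\<epsilon> ^ k * b)) ^ n = (\<epsilon> ^ k) ^ n * (- b) ^ n"
      by (simp flip: power_mult_distrib)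
    also have "(\<epsilon> ^ k) ^ n = 1" using \<epsilon> by (metis power_mult mult.commute power_one)
    finally show "poly p (- (\<epsilon> ^ k * b)) = 0" by (simp add: p_def poly_monom)
  qed (use lc deg in simp_all)
  hence "poly p w = (\<Prod>k<n. w + \<epsilon> ^ k * b)" by (simp add: poly_prod add.commute)
  thus ?thesis by (simp add: p_def poly_monom)
qed

lemma prod_shift_root_of_unity:
  fixes \<epsilon> :: "'a::comm_monoid_mult" and F :: "'a \<Rightarrow> 'b::comm_monoid_mult"
  assumes "\<epsilon> ^ n = 1"
  shows "(\<Prod>k=1..n. F (\<epsilon> ^ k)) = (\<Prod>k<n. F (\<epsilon> ^ k))"
proof (cases n)
  case (Suc m)
  have "(\<Prod>k=1..Suc m. F (\<epsilon> ^ k)) = (\<Prod>k<m. F (\<epsilon> ^ Suc k)) * F (\<epsilon> ^ Suc m)"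
    by (simp only: One_nat_def prod.atLeast1_atMost_eq prod.lessThan_Suc)
  also have "F (\<epsilon> ^ Suc m) = F (\<epsilon> ^ 0)" using assms Suc by simp
  also have "(\<Prod>k<m. F (\<epsilon> ^ Suc k)) * F (\<epsilon> ^ 0) = (\<Prod>k<Suc m. F (\<epsilon> ^ k))"
    by (subst prod.lessThan_Suc_shift) (rule mult.commute)
  finally show ?thesis by (simp only: Suc)
qed simp

text \<open>The left product ranges over the same linear factors as \<open>\<Prod>\<^sub>t \<Prod>\<^sub>k (w + \<epsilon>\<^sup>k (u + \<epsilon>\<^sup>t v))\<close>: for fixed
  \<open>k\<close>, the exponent \<open>k + t\<close> runs through all residues modulo \<open>n\<close> together with \<open>t\<close>.\<close>

lemma double_prod_roots_of_unity:
  fixes w u v \<epsilon> :: "'a::field"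
  assumes n: "0 < n" and \<epsilon>: "\<epsilon> ^ n = 1" and inj: "inj_on (\<lambda>k. \<epsilon> ^ k) {..<n}"
  shows "(\<Prod>r=1..n. \<Prod>s=1..n. w + \<epsilon> ^ r * u + \<epsilon> ^ s * v) =
    (\<Prod>t<n. w ^ n - (-1) ^ n * (u + \<epsilon> ^ t * v) ^ n)"
proof -
  note prod1 = prod_roots_of_unity[OF n \<epsilon> inj]
  have eps: "(\<epsilon> ^ k) ^ n = 1" for k using \<epsilon> by (metis power_mult mult.commute power_one)
  have "(\<Prod>r=1..n. \<Prod>s=1..n. w + \<epsilon> ^ r * u + \<epsilon> ^ s * v) =
      (\<Prod>r<n. \<Prod>s<n. w + \<epsilon> ^ r * u + \<epsilon> ^ s * v)"
    by (subst prod_shift_root_of_unity[OF \<epsilon>, of "\<lambda>x. \<Prod>s=1..n. w + x * u + \<epsilon> ^ s * v"],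
        subst prod_shift_root_of_unity[OF \<epsilon>]) (rule refl)
  also have "\<dots> = (\<Prod>r<n. (w + \<epsilon> ^ r * u) ^ n - (- v) ^ n)"
    by (simp only: prod1)
  also have "\<dots> = (\<Prod>r<n. (w + \<epsilon> ^ r * u) ^ n - (- (\<epsilon> ^ r * v)) ^ n)"
  proof -
    have "(- (\<epsilon> ^ r * v)) ^ n = (\<epsilon> ^ r) ^ n * (- v) ^ n" for r
      by (simp flip: power_mult_distrib)
    thus ?thesis by (simp add: eps)
  qed
  also have "\<dots> = (\<Prod>r<n. \<Prod>t<n. w + \<epsilon> ^ r * u + \<epsilon> ^ t * (\<epsilon> ^ r * v))"
    by (simp only: prod1)
  also have "\<dots> = (\<Prod>t<n. \<Prod>r<n. w + \<epsilon> ^ r * (u + \<epsilon> ^ t * v))"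
    by (subst prod.swap) (simp add: algebra_simps)
  also have "\<dots> = (\<Prod>t<n. w ^ n - (- (u + \<epsilon> ^ t * v)) ^ n)"
    by (simp only: prod1)
  also have "\<dots> = (\<Prod>t<n. w ^ n - (-1) ^ n * (u + \<epsilon> ^ t * v) ^ n)"
    by (simp flip: power_mult_distrib)
  finally show ?thesis .
qed

section \<open>An integral matrix of multiplication by \<theta>\<close>

text \<open>For \<open>x = u\<^sup>n\<close> and \<open>y = v\<^sup>n\<close> this is the matrix of multiplication by \<open>c (u + v)\<^sup>n\<close> on the elements
  \<open>e\<^sub>j = v\<^sup>j u\<^bsup>n-j\<^esup>\<close> with \<open>j < n\<close>. A binomial term \<open>v\<^sup>k u\<^bsup>n-k\<^esup>\<close> sends \<open>e\<^sub>i\<close> to \<open>x e\<^bsub>i+k\<^esub>\<close> if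
  \<open>i + k < n\<close>, and to \<open>y e\<^bsub>i+k-n\<^esub>\<close> otherwise. Only \<open>x\<close> and \<open>y\<close> enter, not the roots \<open>u\<close> and \<open>v\<close>.\<close>

definition shift_matrix :: "'a::comm_ring_1 \<Rightarrow> 'a \<Rightarrow> 'a \<Rightarrow> nat \<Rightarrow> 'a mat" where
  "shift_matrix c x y n = mat n n (\<lambda>(i, j). c *
     ((if i \<le> j then of_nat (n choose (j - i)) * x else 0) +
      (if j \<le> i then of_nat (n choose (i - j)) * y else 0)))"

lemma shift_matrix_carrier [simp]: "shift_matrix c x y n \<in> carrier_mat n n"
  by (simp add: shift_matrix_def)

lemma (in comm_ring_hom) map_shift_matrix:
  "map_mat hom (shift_matrix c x y n) = shift_matrix (hom c) (hom x) (hom y) n"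
  by (rule eq_matI) (auto simp: shift_matrix_def hom_distribs)

lemma shift_matrix_eigenvector:
  fixes u v :: "'a::comm_ring_1"
  assumes "i < n"
  shows "(\<Sum>j<n. shift_matrix c (u ^ n) (v ^ n) n $$ (i, j) * (v ^ j * u ^ (n - j))) =
    c * (u + v) ^ n * (v ^ i * u ^ (n - i))"
proof -
  have "(u + v) ^ n * (v ^ i * u ^ (n - i)) =
      (\<Sum>k\<le>n. of_nat (n choose k) * (v ^ k * u ^ (n - k) * (v ^ i * u ^ (n - i))))"
    by (subst add.commute) (simp add: binomial_ring sum_distrib_right mult.assoc)
  also have "\<dots> = (\<Sum>k\<in>{..<n - i}. of_nat (n choose k) * (v ^ k * u ^ (n - k) * (v ^ i * u ^ (n - i)))) +
      (\<Sum>k\<in>{n - i..n}. of_nat (n choose k) * (v ^ k * u ^ (n - k) * (v ^ i * u ^ (n - i))))"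
    by (subst sum.union_disjoint[symmetric]) (auto intro!: sum.cong)
  also have "(\<Sum>k\<in>{..<n - i}. of_nat (n choose k) * (v ^ k * u ^ (n - k) * (v ^ i * u ^ (n - i)))) =
      (\<Sum>j\<in>{i..<n}. of_nat (n choose (j - i)) * u ^ n * (v ^ j * u ^ (n - j)))"
  proof (rule sum.reindex_bij_witness[of _ "\<lambda>j. j - i" "\<lambda>k. k + i"])
    fix k assume k: "k \<in> {..<n - i}"
    have "v ^ k * u ^ (n - k) * (v ^ i * u ^ (n - i)) = v ^ (k + i) * u ^ ((n - k) + (n - i))"
      by (simp add: power_add ac_simps)
    also have "(n - k) + (n - i) = n + (n - (k + i))" using k by auto
    finally show "of_nat (n choose (k + i - i)) * u ^ n * (v ^ (k + i) * u ^ (n - (k + i))) =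
        of_nat (n choose k) * (v ^ k * u ^ (n - k) * (v ^ i * u ^ (n - i)))"
      by (simp add: power_add ac_simps)
  qed auto
  also have "(\<Sum>k\<in>{n - i..n}. of_nat (n choose k) * (v ^ k * u ^ (n - k) * (v ^ i * u ^ (n - i)))) =
      (\<Sum>j\<in>{..i}. of_nat (n choose (i - j)) * v ^ n * (v ^ j * u ^ (n - j)))"
  proof (rule sum.reindex_bij_witness[of _ "\<lambda>j. n + j - i" "\<lambda>k. k + i - n"])
    fix k assume k: "k \<in> {n - i..n}"
    have "v ^ k * u ^ (n - k) * (v ^ i * u ^ (n - i)) = v ^ (k + i) * u ^ ((n - k) + (n - i))"
      by (simp add: power_add ac_simps)
    also have "(n - k) + (n - i) = n - (k + i - n)" using k assms by auto
    also have "v ^ (k + i) = v ^ n * v ^ (k + i - n)"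
    proof -
      have "k + i = n + (k + i - n)" using k by auto
      thus ?thesis by (metis power_add)
    qed
    finally have "v ^ k * u ^ (n - k) * (v ^ i * u ^ (n - i)) =
        v ^ n * v ^ (k + i - n) * u ^ (n - (k + i - n))" .
    moreover have "n choose k = n choose (i - (k + i - n))"
    proof -
      have "i - (k + i - n) = n - k" using k by auto
      thus ?thesis using k binomial_symmetric[of k n] by simp
    qed
    ultimately show "of_nat (n choose (i - (k + i - n))) * v ^ n * (v ^ (k + i - n) * u ^ (n - (k + i - n))) =
        of_nat (n choose k) * (v ^ k * u ^ (n - k) * (v ^ i * u ^ (n - i)))"
      by (simp add: mult.assoc)
  qed (use assms in auto)
  also have "(\<Sum>j\<in>{i..<n}. of_nat (n choose (j - i)) * u ^ n * (v ^ j * u ^ (n - j))) =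
      (\<Sum>j<n. (if i \<le> j then of_nat (n choose (j - i)) * u ^ n else 0) * (v ^ j * u ^ (n - j)))"
    by (rule sum.mono_neutral_cong_left) auto
  also have "(\<Sum>j\<in>{..i}. of_nat (n choose (i - j)) * v ^ n * (v ^ j * u ^ (n - j))) =
      (\<Sum>j<n. (if j \<le> i then of_nat (n choose (i - j)) * v ^ n else 0) * (v ^ j * u ^ (n - j)))"
    by (rule sum.mono_neutral_cong_left) (use assms in auto)
  finally have main: "(u + v) ^ n * (v ^ i * u ^ (n - i)) =
      (\<Sum>j<n. (if i \<le> j then of_nat (n choose (j - i)) * u ^ n else 0) * (v ^ j * u ^ (n - j))) +
      (\<Sum>j<n. (if j \<le> i then of_nat (n choose (i - j)) * v ^ n else 0) * (v ^ j * u ^ (n - j)))" .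
  show ?thesis
    unfolding mult.assoc[of c] main using assms
    by (simp add: shift_matrix_def sum_distrib_left distrib_left distrib_right sum.distrib mult.assoc
        del: mult_cancel_left)
qed

text \<open>Since \<open>(\<epsilon>\<^sup>t v)\<^sup>n = v\<^sup>n\<close>, replacing \<open>v\<close> by \<open>\<epsilon>\<^sup>t v\<close> does not change the matrix but produces an
  eigenvector for each of the \<open>n\<close> distinct eigenvalues.\<close>

lemma char_poly_shift_matrix:
  fixes u v \<epsilon> :: "'a::field"
  assumes n: "0 < n" and \<epsilon>: "\<epsilon> ^ n = 1" and u: "u \<noteq> 0"
    and inj: "inj_on (\<lambda>t. c * (u + \<epsilon> ^ t * v) ^ n) {..<n}"
  shows "char_poly (shift_matrix c (u ^ n) (v ^ n) n) = (\<Prod>t<n. [:- (c * (u + \<epsilon> ^ t * v) ^ n), 1:])"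
proof -
  let ?A = "shift_matrix c (u ^ n) (v ^ n) n"
  have A: "?A \<in> carrier_mat n n" by simp
  show ?thesis
  proof (rule monic_poly_eq_prod_roots[OF _ _ inj])
    show "lead_coeff (char_poly ?A) = 1" "degree (char_poly ?A) = n"
      using degree_monic_char_poly[OF A] by auto
    fix t assume "t < n"
    have vn: "(\<epsilon> ^ t * v) ^ n = v ^ n"
      using \<epsilon> by (simp add: power_mult_distrib flip: power_mult) (simp add: mult.commute[of t] power_mult)
    define w where "w = vec n (\<lambda>j. (\<epsilon> ^ t * v) ^ j * u ^ (n - j))"
    have "?A *\<^sub>v w = (c * (u + \<epsilon> ^ t * v) ^ n) \<cdot>\<^sub>v w"
    proof (rule eq_vecI)
      fix i assume "i < dim_vec ((c * (u + \<epsilon> ^ t * v) ^ n) \<cdot>\<^sub>v w)"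
      hence i: "i < n" by (simp add: w_def)
      have "(?A *\<^sub>v w) $ i = (\<Sum>j<n. ?A $$ (i, j) * ((\<epsilon> ^ t * v) ^ j * u ^ (n - j)))"
        using i carrier_matD[OF A] by (simp add: w_def scalar_prod_def atLeast0LessThan)
      also have "\<dots> = c * (u + \<epsilon> ^ t * v) ^ n * ((\<epsilon> ^ t * v) ^ i * u ^ (n - i))"
        using shift_matrix_eigenvector[OF i, of c u "\<epsilon> ^ t * v"] unfolding vn .
      finally show "(?A *\<^sub>v w) $ i = ((c * (u + \<epsilon> ^ t * v) ^ n) \<cdot>\<^sub>v w) $ i"
        using i by (simp add: w_def)
    qed (simp add: w_def carrier_matD[OF A])
    moreover have "w \<noteq> 0\<^sub>v n"
    proof
      assume "w = 0\<^sub>v n"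
      hence "w $ 0 = 0" using n by simp
      thus False using n u by (simp add: w_def)
    qed
    ultimately have "eigenvalue ?A (c * (u + \<epsilon> ^ t * v) ^ n)"
      unfolding eigenvalue_def eigenvector_def by (intro exI[of _ w]) (simp add: w_def carrier_matD[OF A])
    thus "poly (char_poly ?A) (c * (u + \<epsilon> ^ t * v) ^ n) = 0"
      using eigenvalue_root_char_poly[OF A] by simp
  qed
qed

section \<open>The conjugates of \<theta>\<close>

abbreviation (input) "embedZ \<equiv> (\<lambda>c. Qxy_embed (Zxy_to_Qxy c))"

lemma inj_comm_ring_hom_embedZ: "inj_comm_ring_hom embedZ"
proof -
  interpret Z: inj_comm_ring_hom Zxy_to_Qxy by (rule inj_comm_ring_hom_Zxy_to_Qxy)
  interpret Q: field_hom Qxy_embed by (rule field_hom_Qxy_embed)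
  show ?thesis by unfold_locales (auto simp: Z.hom_add Q.hom_add Z.hom_mult Q.hom_mult)
qed

context
  fixes n :: nat and u v :: Cxy_closure
  assumes n: "n \<ge> 2" and u: "u ^ n = Qxy_embed X_var" and v: "v ^ n = Qxy_embed Y_var"
begin

abbreviation (input) "\<epsilon> \<equiv> root_of_unity n"
abbreviation (input) "theta t \<equiv> (u + \<epsilon> ^ t * v) ^ n"

lemma eps: "\<epsilon> ^ n = 1" "inj_on (\<lambda>k. \<epsilon> ^ k) {..<n}" "0 < n"
  using n root_of_unity_power inj_root_of_unity_power by auto

lemma u_nonzero: "u \<noteq> 0"
  using u eps by (auto simp: Qxy_embed_vars power_0_left)

lemma relation_divisible:
  assumes "poly (map_poly to_ac f) (v / u) = 0"
  shows "monom 1 n - [:to_fract [:0, 1:] / to_fract [:[:0, 1:]:]:] dvd f"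
proof (rule kummer_divides[OF field_hom_to_ac eps(3) _ _ assms])
  show "(v / u) ^ n = to_ac (to_fract [:0, 1:] / to_fract [:[:0, 1:]:])"
    by (simp add: power_divide u v Qxy_embed_vars)
qed (rule Y_over_X_power_no_root)

text \<open>Both \<open>v / u\<close> and \<open>\<epsilon>\<^sup>t v / u\<close> are roots of \<open>T\<^sup>n - y/x\<close>.\<close>

lemma relation_conjugate:
  assumes "poly (map_poly to_ac f) (v / u) = 0"
  shows "poly (map_poly to_ac f) (\<epsilon> ^ t * v / u) = 0"
proof -
  interpret field_hom "to_ac :: Cxy \<Rightarrow> Cxy_closure" by (rule field_hom_to_ac)
  interpret m: map_poly_inj_idom_hom "to_ac :: Cxy \<Rightarrow> Cxy_closure" ..
  let ?a = "to_fract [:0, 1:] / to_fract [:[:0, 1:]:] :: Cxy"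
  obtain q where "f = (monom 1 n - [:?a:]) * q"
    using relation_divisible[OF assms] by (elim dvdE)
  moreover have "poly (map_poly to_ac (monom 1 n - [:?a:])) (\<epsilon> ^ t * v / u) = 0"
  proof -
    have "(\<epsilon> ^ t) ^ n = 1" using eps(1) by (metis power_mult mult.commute power_one)
    thus ?thesis
      unfolding m.hom_minus
      by (simp add: poly_monom hom_distribs power_divide power_mult_distrib u v Qxy_embed_vars)
  qed
  ultimately show ?thesis by (simp add: m.hom_mult)
qed

text \<open>Substituting \<open>x (1 + T)\<^sup>n\<close> into \<open>g\<close> turns a relation for \<open>\<theta>\<close> into one for \<open>v / u\<close>.\<close>

lemma theta_conjugate:
  assumes "poly (map_poly Qxy_embed g) (theta 0) = 0"
  shows "poly (map_poly Qxy_embed g) (theta t) = 0"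
proof -
  interpret ac: field_hom "to_ac :: Cxy \<Rightarrow> Cxy_closure" by (rule field_hom_to_ac)
  interpret QC: field_hom Qxy_to_Cxy by (rule field_hom_Qxy_to_Cxy)
  let ?X = "to_fract [:[:0, 1:]:] :: Cxy"
  define f where "f = map_poly Qxy_to_Cxy g \<circ>\<^sub>p smult ?X ([:1, 1:] ^ n)"
  have comp: "map_poly to_ac (map_poly Qxy_to_Cxy g) = map_poly Qxy_embed g"
    using map_poly_map_poly[of to_ac Qxy_to_Cxy g] by (simp add: o_def Qxy_embed_def[abs_def])
  interpret m: map_poly_inj_idom_hom "to_ac :: Cxy \<Rightarrow> Cxy_closure" ..
  have "map_poly to_ac (smult ?X ([:1, 1:] ^ n)) = smult (to_ac ?X) ([:1, 1:] ^ n)"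
    by (simp add: ac.map_poly_hom_smult m.hom_power map_poly_pCons)
  hence f: "poly (map_poly to_ac f) z = poly (map_poly Qxy_embed g) (to_ac ?X * (1 + z) ^ n)" for z
    unfolding f_def ac.map_poly_pcompose comp by (simp add: poly_pcompose add.commute)
  have conv: "to_ac ?X * (1 + \<epsilon> ^ t * v / u) ^ n = theta t" for t
    unfolding Qxy_embed_vars(1)[symmetric] u[symmetric] power_mult_distrib[symmetric]
    using u_nonzero by (simp add: distrib_left)
  have "poly (map_poly to_ac f) (v / u) = 0"
    using assms conv[of 0] by (simp add: f)
  from relation_conjugate[OF this, of t] show ?thesis unfolding f conv .
qed

text \<open>If \<open>\<theta>\<^sub>t = \<theta>\<^sub>r\<close>, then \<open>u + \<epsilon>\<^sup>t v = \<epsilon>\<^sup>k (u + \<epsilon>\<^sup>r v)\<close> for some \<open>k\<close>. This is a relation of degree at most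
  one for \<open>v / u\<close> over \<open>\<complex>(x,y)\<close>, so it is trivial as \<open>n \<ge> 2\<close>.\<close>

lemma inj_theta: "inj_on (\<lambda>t. theta t) {..<n}"
proof (rule inj_onI)
  interpret ac: field_hom "to_ac :: Cxy \<Rightarrow> Cxy_closure" by (rule field_hom_to_ac)
  fix t r assume tr: "t \<in> {..<n}" "r \<in> {..<n}" and eq: "theta t = theta r"
  have "(\<Prod>k<n. (u + \<epsilon> ^ t * v) + \<epsilon> ^ k * (- (u + \<epsilon> ^ r * v))) = 0"
    unfolding prod_roots_of_unity[OF eps(3,1,2)] using eq by (simp only: minus_minus diff_self)
  then obtain k where "(u + \<epsilon> ^ t * v) + \<epsilon> ^ k * (- (u + \<epsilon> ^ r * v)) = 0"
    unfolding prod_zero_iff[OF finite_lessThan] by blast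
  hence k: "u + \<epsilon> ^ t * v = \<epsilon> ^ k * (u + \<epsilon> ^ r * v)"
    by (simp only: mult_minus_right eq_neg_iff_add_eq_0[symmetric] minus_minus)
  obtain e where e: "\<epsilon> = to_ac e" by (simp add: root_of_unity_def)
  define f where "f = [:1 - e ^ k, e ^ t - e ^ k * e ^ r:]"
  have "poly (map_poly to_ac f) (v / u) = 0"
  proof -
    have "map_poly to_ac f = [:1 - \<epsilon> ^ k, \<epsilon> ^ t - \<epsilon> ^ k * \<epsilon> ^ r:]"
      unfolding f_def e by (simp add: ac.map_poly_pCons_hom)
    hence "poly (map_poly to_ac f) (v / u) = ((u + \<epsilon> ^ t * v) - \<epsilon> ^ k * (u + \<epsilon> ^ r * v)) / u"
      using u_nonzero by (simp add: field_simps)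
    thus ?thesis by (simp add: k)
  qed
  from relation_divisible[OF this] have dvd: "monom 1 n - [:to_fract [:0, 1:] / to_fract [:[:0, 1:]:]:] dvd f" .
  have "f = 0"
  proof (rule ccontr)
    assume "f \<noteq> 0"
    have "coeff (monom 1 n - [:to_fract [:0, 1:] / to_fract [:[:0, 1:]:]:]) n = (1 :: Cxy)"
      using eps(3) by (cases n) auto
    hence "n \<le> degree (monom 1 n - [:to_fract [:0, 1:] / to_fract [:[:0, 1:]:]:] :: Cxy poly)"
      by (intro le_degree) simp
    also have "\<dots> \<le> degree f" by (rule dvd_imp_degree_le[OF dvd \<open>f \<noteq> 0\<close>])
    also have "\<dots> \<le> 1" by (simp add: f_def)
    finally show False using n by simp
  qed
  hence "e ^ k = 1" "e ^ t = e ^ r" by (auto simp: f_def)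
  hence "\<epsilon> ^ t = \<epsilon> ^ r" unfolding e by (simp flip: to_ac_power)
  thus "t = r" using eps(2) tr by (auto dest: inj_onD)
qed

lemma char_poly_thetas:
  assumes "c \<noteq> 0"
  shows "char_poly (shift_matrix c (Qxy_embed X_var) (Qxy_embed Y_var) n) =
    (\<Prod>t<n. [:- (c * theta t), 1:])"
  unfolding u[symmetric] v[symmetric]
  by (rule char_poly_shift_matrix[OF eps(3,1) u_nonzero])
    (use inj_theta assms in \<open>simp add: inj_on_def\<close>)

text \<open>The integral characteristic polynomial with \<open>c = (-1)\<^sup>n\<close> satisfies the defining property of
  \<open>p_poly\<close>. It is the only one, because every \<open>z\<close> is an \<open>n\<close>-th power and the coefficients embed
  injectively.\<close>

lemma map_p_poly: "map_poly embedZ (p_poly n u v) = (\<Prod>t<n. [:- ((-1) ^ n * theta t), 1:])"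
proof -
  interpret H: inj_comm_ring_hom embedZ by (rule inj_comm_ring_hom_embedZ)
  interpret m: map_poly_inj_comm_ring_hom embedZ ..
  define q where "q = char_poly (shift_matrix ((-1) ^ n) [:[:0, 1:]:] [:0, 1:] n :: int poly poly mat)"
  have vars: "embedZ [:[:0, 1:]:] = Qxy_embed X_var" "embedZ [:0, 1:] = Qxy_embed Y_var"
    by (simp_all add: Zxy_to_Qxy_def X_var_def Y_var_def map_poly_pCons)
  have q: "map_poly embedZ q = (\<Prod>t<n. [:- ((-1) ^ n * theta t), 1:])"
    unfolding q_def H.char_poly_hom[OF shift_matrix_carrier, symmetric] H.map_shift_matrix vars
    by (simp add: char_poly_thetas H.hom_power H.hom_uminus)
  have eval: "poly (map_poly embedZ q) (w ^ n) = (\<Prod>r=1..n. \<Prod>s=1..n. w + \<epsilon> ^ r * u + \<epsilon> ^ s * v)" for w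
    unfolding q double_prod_roots_of_unity[OF eps(3,1,2)] by (simp add: poly_prod)
  have "p_poly n u v = q"
    unfolding p_poly_def
  proof (rule the_equality)
    fix p assume p: "\<forall>w. poly (map_poly embedZ p) (w ^ n) =
      (\<Prod>r=1..n. \<Prod>s=1..n. w + \<epsilon> ^ r * u + \<epsilon> ^ s * v)"
    have "poly (map_poly embedZ p) z = poly (map_poly embedZ q) z" for z
    proof -
      obtain w where "w ^ n = z" using nth_root_exists[OF eps(3), of z] by blast
      thus ?thesis using p eval by metis
    qed
    hence "map_poly embedZ p = map_poly embedZ q"
      by (intro poly_eq_poly_eq_iff[THEN iffD1] ext)
    thus "p = q" by simp
  qed (use eval in simp)
  thus ?thesis using q by simp
qed

text \<open>Over \<open>\<rat>(x,y)\<close> the same matrix, now with \<open>c = 1\<close>, has the minimal polynomial of \<open>\<theta>\<close> as its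
  characteristic polynomial.\<close>

lemma conjugate_roots_Qxy_embed:
  "conjugate_roots Qxy_embed n (\<lambda>t. theta t) (char_poly (shift_matrix 1 X_var Y_var n))"
proof -
  interpret Q: field_hom Qxy_embed by (rule field_hom_Qxy_embed)
  show ?thesis
  proof unfold_locales
    show "map_poly Qxy_embed (char_poly (shift_matrix 1 X_var Y_var n)) = (\<Prod>i<n. [:- theta i, 1:])"
      unfolding Q.char_poly_hom[OF shift_matrix_carrier, symmetric] Q.map_shift_matrix
      using char_poly_thetas[of 1] by simp
  qed (use eps(3) inj_theta theta_conjugate in auto)
qed

end

theorem proposition15:
  fixes n :: nat and u v \<theta> :: Cxy_closure
  assumes "n \<ge> 2"
    and "u ^ n = Qxy_embed X_var"
    and "v ^ n = Qxy_embed Y_var"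
    and "\<theta> = (u + v) ^ n"
  shows "Zxy_to_Qxy (poly_discriminant (p_poly n u v)) =
    ext_discriminant Qxy_embed (Qxy_adjoin \<theta>) n (\<lambda>i. \<theta> ^ i)"
proof -
  define \<alpha> where "\<alpha> t = (u + root_of_unity n ^ t * v) ^ n" for t
  interpret conjugate_roots Qxy_embed n \<alpha> "char_poly (shift_matrix 1 X_var Y_var n)"
    unfolding \<alpha>_def by (rule conjugate_roots_Qxy_embed[OF assms(1-3)])
  have \<theta>: "\<theta> = \<alpha> 0" by (simp add: \<alpha>_def assms)
  have "Qxy_embed (Zxy_to_Qxy (poly_discriminant (p_poly n u v))) =
      (\<Prod>k<n. \<Prod>j<k. (-1) ^ n * \<alpha> k - (-1) ^ n * \<alpha> j)\<^sup>2"
    by (rule poly_discriminant_hom[OF inj_comm_ring_hom_embedZ])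
      (use distinct map_p_poly[OF assms(1-3)] in \<open>simp_all add: inj_on_def \<alpha>_def\<close>)
  also have "\<dots> = ((\<Prod>k<n. \<Prod>j<k. (-1) ^ n) * (\<Prod>k<n. \<Prod>j<k. \<alpha> k - \<alpha> j))\<^sup>2"
    by (simp only: prod.distrib[symmetric] right_diff_distrib)
  also have "\<dots> = (\<Prod>k<n. \<Prod>j<k. ((-1) ^ n)\<^sup>2) * (\<Prod>k<n. \<Prod>j<k. \<alpha> k - \<alpha> j)\<^sup>2"
    by (simp only: power_mult_distrib prod_power_distrib)
  also have "((-1) ^ n)\<^sup>2 = (1 :: Cxy_closure)"
    by (simp flip: power_mult)
  finally have "Qxy_embed (Zxy_to_Qxy (poly_discriminant (p_poly n u v))) =
      Qxy_embed (ext_discriminant Qxy_embed (Qxy_adjoin \<theta>) n (\<lambda>i. \<theta> ^ i))"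
    unfolding \<theta> Qxy_adjoin_def discriminant_powers by simp
  thus ?thesis by simp
qed

end
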